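(* Let $k,r\ge 2$ be integers, let $\Gamma$ be the symmetric graph of type $k$ and order $r$, let $G$ be a group acting isometrically and simply transitively on $\Gamma$ (identified with the vertex set), and put $Q=(r-1)(k-1)$. (1) For all $1\le p\le 2$, the Abel transform $\mathcal A$ extends to a continuous homomorphism (continuous linear map) from $\mathcal S_p(G)^{\sharp}$ to $Q^{-(\frac1p-\frac12)|\cdot|}\,\mathcal S(\mathbb Z)_{\mathrm{even}}$. (2) If $k\le r$, then $\mathcal A^{-1}$ is a continuous homomorphism from $Q^{-(\frac1p-\frac12)|\cdot|}\,\mathcal S(\mathbb Z)_{\mathrm{even}}$ to $\mathcal S_p(G)^{\sharp}$, for all $1\le p\le 2$. (3) If $k>r$, then $\mathcal A^{-1}$ is a continuous homomorphism from $Q^{-\frac12|\cdot|}\,\mathcal S(\mathbb Z)_{\mathrm{even}}$ to $\mathcal S_1(G)^{\sharp}$.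
   Context: Symmetric graph: $\Gamma$ is a connected graph in which every vertex $v$ belongs to exactly $r$ polygons with $k$ sides each (for $k=2$ a polygon is a single edge), these polygons having no side and no vertex in common except $v$, and such that every nontrivial loop runs through all the edges of at least one polygon. Its vertex set is $\mathcal V$, identified with $G$. The distance $d(x,y)$ is the minimal number of polygons crossed by a path connecting $x$ with $y$. Fix an origin $o\in\mathcal V$ and put $|x|=d(x,o)$. Boundary: $\Omega$ is the set of geodesic rays starting at $o$; a ray $\omega$ is identified with its sequence of nodes $\omega_0=o,\omega_1,\omega_2,\dots$, with $d(\omega_i,\omega_j)=|i-j|$. The Busemann function is $\zeta(x,\omega)=d(o,\omega_m)-d(x,\omega_m)$ for $m>|x|$ (independent of such $m$), and the horocycles are $H_h(\omega)=\{x:\zeta(x,\omega)=h\}$, $h\in\mathbb Z$. A function on $G$ is radial if it depends only on $|x|$; then $f(n)$ is its value at $|x|=n$. A superscript $\sharp$ denotes the subspace of radial functions; the subscript "even" denotes the subspace of even functions on $\mathbb Z$; $\mathcal D$ denotes finitely supported functions. Abel transform: for $f\in\mathcal D(G)^{\sharp}$ and $h\in\mathbb Z$, $\mathcal Af(h)=Q^{h/2}\sum_{x\in H_h(\omega)}f(x)$, independent of $\omega\in\Omega$; explicitly $$\mathcal Af(h)=Q^{\frac{|h|}2}f(|h|)+(k-2)\sum_{j\ge1}Q^{\frac{|h|}2+j-1}f(|h|+2j-1)+\frac{r-2}{r-1}\sum_{j\ge1}Q^{\frac{|h|}2+j}f(|h|+2j).$$ $\mathcal A^{-1}$ is the inverse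 transform, given by $$\mathcal A^{-1}g(n)=\frac1k\,Q^{-\frac{n-1}2}\sum_{m\ge1}\big[1+(-1)^{m-1}(k-1)^m\big]Q^{-\frac m2}\,[g(n+m-1)-g(n+m+1)],\quad n\in\mathbb N.$$ Schwartz spaces: for $0<p<\infty$, $\mathcal S_p(G)$ is the Fréchet space of functions $f:G\to\mathbb C$ with $\|f\|_{(p,m)}=\sup_{x\in G}(1+|x|)^mQ^{|x|/p}|f(x)|<\infty$ for all $m\in\mathbb N$. $\mathcal S(\mathbb Z)_{\mathrm{even}}$ is the space of even functions $g:\mathbb Z\to\mathbb C$ with $\|g\|_{(m)}=\sup_{n\in\mathbb Z}(1+|n|)^m|g(n)|<\infty$ for all $m\in\mathbb N$. For $a\ge 0$, $Q^{-a|\cdot|}\mathcal S(\mathbb Z)_{\mathrm{even}}$ is the space of even functions $g$ with $Q^{a|\cdot|}g\in\mathcal S(\mathbb Z)_{\mathrm{even}}$, topologized by the norms $\|Q^{a|\cdot|}g\|_{(m)}$. *)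

theory Defs
  imports "HOL-Analysis.Analysis" "HOL-Algebra.Group_Action"
begin

section \<open>Symmetric graphs\<close>

text \<open>
  A graph is given by its adjacency relation on the type of vertices. A list of distinct vertices
  in which each vertex is adjacent to its cyclic successor is a simple closed path. For length 2
  this is an edge run through back and forth, and its set of sides is the single edge. Hence
  polygons, identified with their sets of sides, are covered uniformly for all \<open>k \<ge> 2\<close>.
\<close>

definition closed_path :: "('v \<Rightarrow> 'v \<Rightarrow> bool) \<Rightarrow> 'v list \<Rightarrow> bool" where
  "closed_path E xs \<longleftrightarrow>
     distinct xs \<and> (\<forall>i<length xs. E (xs ! i) (xs ! (Suc i mod length xs)))"

definition closed_path_sides :: "'v list \<Rightarrow> 'v set set" where
  "closed_path_sides xs = {{xs ! i, xs ! (Suc i mod length xs)} | i. i < length xs}"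

definition polygons :: "('v \<Rightarrow> 'v \<Rightarrow> bool) \<Rightarrow> nat \<Rightarrow> 'v set set set" where
  "polygons E k = {closed_path_sides xs | xs. length xs = k \<and> closed_path E xs}"

text \<open>
  In the last clause a nontrivial loop is a simple closed path with at least three vertices; a
  closed path without backtracking always contains one. For \<open>k = 2\<close> a polygon has to be traversed
  back and forth, which such a loop cannot do, so that there are no nontrivial loops and the graph
  is a tree. The clause that every edge is a side of a polygon is implicit in the distance being
  counted in polygons.
\<close>

definition symmetric_graph :: "('v \<Rightarrow> 'v \<Rightarrow> bool) \<Rightarrow> nat \<Rightarrow> nat \<Rightarrow> bool" where
  "symmetric_graph E k r \<longleftrightarrow>
     symp E \<and> irreflp E \<and> (\<forall>x y. E\<^sup>*\<^sup>* x y) \<and>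
     (\<forall>x y. E x y \<longrightarrow> (\<exists>P\<in>polygons E k. {x, y} \<in> P)) \<and>
     (\<forall>v. card {P \<in> polygons E k. v \<in> \<Union>P} = r) \<and>
     (\<forall>v. \<forall>P\<in>polygons E k. \<forall>P'\<in>polygons E k.
        P \<noteq> P' \<and> v \<in> \<Union>P \<and> v \<in> \<Union>P' \<longrightarrow> P \<inter> P' = {} \<and> \<Union>P \<inter> \<Union>P' = {v}) \<and>
     (\<forall>xs. closed_path E xs \<and> 3 \<le> length xs \<longrightarrow>
        k \<noteq> 2 \<and> (\<exists>P\<in>polygons E k. P \<subseteq> closed_path_sides xs))"

definition path_sides :: "'v list \<Rightarrow> 'v set set" where
  "path_sides xs = {{xs ! i, xs ! Suc i} | i. Suc i < length xs}"

definition crossed_polygons :: "('v \<Rightarrow> 'v \<Rightarrow> bool) \<Rightarrow> nat \<Rightarrow> 'v list \<Rightarrow> 'v set set set" where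
  "crossed_polygons E k xs = {P \<in> polygons E k. P \<inter> path_sides xs \<noteq> {}}"

definition poly_dist :: "('v \<Rightarrow> 'v \<Rightarrow> bool) \<Rightarrow> nat \<Rightarrow> 'v \<Rightarrow> 'v \<Rightarrow> nat" where
  "poly_dist E k x y =
     (LEAST n. \<exists>xs. xs \<noteq> [] \<and> hd xs = x \<and> last xs = y \<and> successively E xs \<and>
                    card (crossed_polygons E k xs) = n)"

definition poly_length :: "('v \<Rightarrow> 'v \<Rightarrow> bool) \<Rightarrow> nat \<Rightarrow> 'v \<Rightarrow> 'v \<Rightarrow> nat" where
  "poly_length E k orig x = poly_dist E k x orig"

text \<open>
  The vertex set is a whole type \<open>'v\<close>. Once an origin is chosen, a simply transitive action
  identifies the group with \<open>'v\<close>, and functions on the group are functions on \<open>'v\<close>.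
\<close>

definition isometric_simply_transitive ::
    "('g, 'b) monoid_scheme \<Rightarrow> ('g \<Rightarrow> 'v \<Rightarrow> 'v) \<Rightarrow> ('v \<Rightarrow> 'v \<Rightarrow> bool) \<Rightarrow> nat \<Rightarrow> bool" where
  "isometric_simply_transitive G \<phi> E k \<longleftrightarrow>
     group_action G (UNIV :: 'v set) \<phi> \<and>
     (\<forall>g\<in>carrier G. \<forall>x y. poly_dist E k (\<phi> g x) (\<phi> g y) = poly_dist E k x y) \<and>
     (\<forall>x y. \<exists>!g. g \<in> carrier G \<and> \<phi> g x = y)"


section \<open>Boundary, horocycles and the Abel transform\<close>

definition boundary :: "('v \<Rightarrow> 'v \<Rightarrow> bool) \<Rightarrow> nat \<Rightarrow> 'v \<Rightarrow> (nat \<Rightarrow> 'v) set" where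
  "boundary E k orig =
     {\<omega>. \<omega> 0 = orig \<and> (\<forall>i j. int (poly_dist E k (\<omega> i) (\<omega> j)) = \<bar>int i - int j\<bar>)}"

text \<open>
  The value of \<open>d(o, \<omega>\<^sub>m) - d(x, \<omega>\<^sub>m)\<close> is the same for all \<open>m > |x|\<close>; here \<open>m = |x| + 1\<close>.
\<close>

definition busemann :: "('v \<Rightarrow> 'v \<Rightarrow> bool) \<Rightarrow> nat \<Rightarrow> 'v \<Rightarrow> 'v \<Rightarrow> (nat \<Rightarrow> 'v) \<Rightarrow> int" where
  "busemann E k orig x \<omega> =
     (let m = Suc (poly_length E k orig x)
      in int (poly_dist E k orig (\<omega> m)) - int (poly_dist E k x (\<omega> m)))"

definition horocycle :: "('v \<Rightarrow> 'v \<Rightarrow> bool) \<Rightarrow> nat \<Rightarrow> 'v \<Rightarrow> (nat \<Rightarrow> 'v) \<Rightarrow> int \<Rightarrow> 'v set" where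
  "horocycle E k orig \<omega> h = {x. busemann E k orig x \<omega> = h}"

text \<open>
  Horocycles may be infinite, so the sum is an \<^const>\<open>infsum\<close>. It is a finite sum if \<open>f\<close> is
  finitely supported.
\<close>

definition abel ::
    "('v \<Rightarrow> 'v \<Rightarrow> bool) \<Rightarrow> nat \<Rightarrow> 'v \<Rightarrow> real \<Rightarrow> (nat \<Rightarrow> 'v) \<Rightarrow> ('v \<Rightarrow> complex) \<Rightarrow> int \<Rightarrow> complex" where
  "abel E k orig Q \<omega> f h =
     of_real (Q powr (of_int h / 2)) * (\<Sum>\<^sub>\<infinity>x\<in>horocycle E k orig \<omega> h. f x)"

definition abel_inv_term :: "nat \<Rightarrow> real \<Rightarrow> (int \<Rightarrow> complex) \<Rightarrow> nat \<Rightarrow> nat \<Rightarrow> complex" where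
  "abel_inv_term k Q g n m =
     of_real ((1 + (- 1) ^ (m - 1) * (real k - 1) ^ m) * Q powr (- real m / 2)) *
     (g (int n + int m - 1) - g (int n + int m + 1))"

definition abel_inv :: "nat \<Rightarrow> real \<Rightarrow> (int \<Rightarrow> complex) \<Rightarrow> nat \<Rightarrow> complex" where
  "abel_inv k Q g n =
     of_real (1 / real k * Q powr (- (real n - 1) / 2)) * (\<Sum>\<^sub>\<infinity>m\<in>{1..}. abel_inv_term k Q g n m)"


section \<open>Schwartz spaces\<close>

text \<open>The topology defined on the function space \<open>S\<close> by the countable family \<open>N\<close> of norms.\<close>

definition norms_topology ::
    "('a \<Rightarrow> complex) set \<Rightarrow> (nat \<Rightarrow> ('a \<Rightarrow> complex) \<Rightarrow> real) \<Rightarrow> ('a \<Rightarrow> complex) topology" where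
  "norms_topology S N =
     topology_generated_by {{g \<in> S. N m (\<lambda>x. g x - f x) < e} | f m e. f \<in> S \<and> 0 < e}"

lemma topspace_norms_topology:
  assumes "\<And>m. N m (\<lambda>x. 0) = 0"
  shows "topspace (norms_topology S N) = S"
proof -
  have "f \<in> \<Union>{{g \<in> S. N m (\<lambda>x. g x - f x) < e} | f m e. f \<in> S \<and> 0 < e}" if "f \<in> S" for f
  proof -
    have "f \<in> {g \<in> S. N 0 (\<lambda>x. g x - f x) < 1}"
      using that assms by simp
    then show ?thesis
      using that zero_less_one by blast
  qed
  then show ?thesis
    unfolding norms_topology_def topology_generated_by_topspace by blast
qed

definition continuous_linear_map ::
    "('a \<Rightarrow> complex) topology \<Rightarrow> ('b \<Rightarrow> complex) topology \<Rightarrow>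
     (('a \<Rightarrow> complex) \<Rightarrow> ('b \<Rightarrow> complex)) \<Rightarrow> bool" where
  "continuous_linear_map X Y T \<longleftrightarrow>
     continuous_map X Y T \<and>
     (\<forall>f\<in>topspace X. \<forall>g\<in>topspace X. T (\<lambda>x. f x + g x) = (\<lambda>y. T f y + T g y)) \<and>
     (\<forall>c. \<forall>f\<in>topspace X. T (\<lambda>x. c * f x) = (\<lambda>y. c * T f y))"

text \<open>
  In the definitions of the spaces, finiteness of a norm is boundedness of the set whose supremum
  is taken; the real-valued \<^const>\<open>Sup\<close> is meaningful only in this case. The parameter \<open>L\<close> is the
  length function \<open>x \<mapsto> |x|\<close>.
\<close>

definition radial :: "('v \<Rightarrow> nat) \<Rightarrow> ('v \<Rightarrow> complex) \<Rightarrow> bool" where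
  "radial L f \<longleftrightarrow> (\<forall>x y. L x = L y \<longrightarrow> f x = f y)"

definition schwartz_weighted ::
    "real \<Rightarrow> ('v \<Rightarrow> nat) \<Rightarrow> real \<Rightarrow> nat \<Rightarrow> ('v \<Rightarrow> complex) \<Rightarrow> 'v \<Rightarrow> real" where
  "schwartz_weighted Q L p m f x = (1 + real (L x)) ^ m * Q powr (real (L x) / p) * cmod (f x)"

definition schwartz_norm ::
    "real \<Rightarrow> ('v \<Rightarrow> nat) \<Rightarrow> real \<Rightarrow> nat \<Rightarrow> ('v \<Rightarrow> complex) \<Rightarrow> real" where
  "schwartz_norm Q L p m f = (SUP x. schwartz_weighted Q L p m f x)"

definition schwartz_radial :: "real \<Rightarrow> ('v \<Rightarrow> nat) \<Rightarrow> real \<Rightarrow> ('v \<Rightarrow> complex) set" where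
  "schwartz_radial Q L p =
     {f. radial L f \<and> (\<forall>m. bdd_above (range (schwartz_weighted Q L p m f)))}"

definition schwartz_radial_topology ::
    "real \<Rightarrow> ('v \<Rightarrow> nat) \<Rightarrow> real \<Rightarrow> ('v \<Rightarrow> complex) topology" where
  "schwartz_radial_topology Q L p = norms_topology (schwartz_radial Q L p) (schwartz_norm Q L p)"

definition schwartz_int_norm :: "nat \<Rightarrow> (int \<Rightarrow> complex) \<Rightarrow> real" where
  "schwartz_int_norm m g = (SUP n. (1 + real_of_int \<bar>n\<bar>) ^ m * cmod (g n))"

definition schwartz_int_even :: "(int \<Rightarrow> complex) set" where
  "schwartz_int_even =
     {g. (\<forall>n. g (- n) = g n) \<and>
         (\<forall>m. bdd_above (range (\<lambda>n. (1 + real_of_int \<bar>n\<bar>) ^ m * cmod (g n))))}"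

definition expweight :: "real \<Rightarrow> real \<Rightarrow> (int \<Rightarrow> complex) \<Rightarrow> int \<Rightarrow> complex" where
  "expweight Q a g n = of_real (Q powr (a * of_int \<bar>n\<bar>)) * g n"

definition weighted_schwartz_even :: "real \<Rightarrow> real \<Rightarrow> (int \<Rightarrow> complex) set" where
  "weighted_schwartz_even Q a =
     {g. (\<forall>n. g (- n) = g n) \<and> expweight Q a g \<in> schwartz_int_even}"

definition weighted_schwartz_even_topology :: "real \<Rightarrow> real \<Rightarrow> (int \<Rightarrow> complex) topology" where
  "weighted_schwartz_even_topology Q a =
     norms_topology (weighted_schwartz_even Q a) (\<lambda>m g. schwartz_int_norm m (expweight Q a g))"

lemma topspace_schwartz_radial_topology [simp]:
  "topspace (schwartz_radial_topology Q L p) = schwartz_radial Q L p"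
  unfolding schwartz_radial_topology_def
  by (rule topspace_norms_topology) (simp add: schwartz_norm_def schwartz_weighted_def)

lemma topspace_weighted_schwartz_even_topology [simp]:
  "topspace (weighted_schwartz_even_topology Q a) = weighted_schwartz_even Q a"
  unfolding weighted_schwartz_even_topology_def
  by (rule topspace_norms_topology) (simp add: schwartz_int_norm_def expweight_def)

end

theory Submission
  imports Defs
begin

text \<open>
  Every polygon has a gate for every vertex, namely the only vertex of the polygon that can be
  reached without running along its sides. The distance of two vertices is the number of polygons
  with different gates for them, so that seen from \<open>z\<close> a vertex \<open>x \<noteq> z\<close> has exactly one neighbour
  closer to \<open>z\<close>, \<open>k - 2\<close> neighbours equally far and \<open>Q\<close> neighbours farther. Double counting of pairs of
  neighbours then gives a wave equation for the number of vertices of a sphere on a horocycle. Its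
  solution is \<open>Q\<close> to the power \<open>(n - h) / 2\<close> times a bounded coefficient depending on \<open>n\<close> and \<open>|h|\<close> only.
  The continuity statements are comparisons with \<open>\<Sum>n. 1 / (1 + n)\<^sup>2\<close>; the condition \<open>k \<le> r\<close>, or
  \<open>p = 1\<close>, enters only through \<open>k - 1 \<le> Q powr (1 / p)\<close>.
\<close>

section \<open>Paths and closed paths\<close>

text \<open>The distance is defined as a minimum over all paths, and a horocycle may be infinite;
  both have to become finite counts. For the distance, gates achieve this: a simple path crosses
  exactly the polygons that separate its ends. For a horocycle, the Busemann function of a vertex of
  length \<open>n\<close> only involves the point \<open>z\<close> of the ray at distance
  \<open>n + 1\<close> from the origin, so the number sought is that of an intersection of two
  spheres, centred at the origin and at \<open>z\<close>. Being neighbours is a symmetric relation,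
  hence the sum over neighbours may be taken in either radius; the \<open>k - 2\<close> sideways
  steps contribute equally and cancel, leaving a discrete wave equation in the two radii. Scaling by
  a power of \<open>Q\<close> balances inward and outward steps, which is the source of the evenness
  in \<open>h\<close>. In the inverse transform the \<open>m\<close>-th coefficient grows like
  \<open>(k - 1)^m Q^(-m/2)\<close>, while \<open>g\<close> supplies the decay
  \<open>Q^(-(1/p - 1/2) m)\<close>; comparing the two rates gives the condition on
  \<open>k - 1\<close>.\<close>

lemma path_sides_Nil [simp]: "path_sides [] = {}"
  and path_sides_singleton [simp]: "path_sides [x] = {}"
  by (auto simp: path_sides_def)

lemma path_sides_Cons_Cons [simp]:
  "path_sides (x # y # zs) = insert {x, y} (path_sides (y # zs))"
proof -
  have "e \<in> path_sides (x # y # zs) \<longleftrightarrow> e = {x, y} \<or> e \<in> path_sides (y # zs)" for e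
  proof -
    have "e \<in> path_sides (x # y # zs) \<longleftrightarrow>
        (\<exists>i<Suc (length zs). e = {(x # y # zs) ! i, (x # y # zs) ! Suc i})"
      by (auto simp: path_sides_def)
    also have "\<dots> \<longleftrightarrow> e = {x, y} \<or> (\<exists>i<length zs. e = {(y # zs) ! i, (y # zs) ! Suc i})"
      unfolding Ex_less_Suc2 by simp
    also have "\<dots> \<longleftrightarrow> e = {x, y} \<or> e \<in> path_sides (y # zs)"
      by (auto simp: path_sides_def)
    finally show ?thesis .
  qed
  then show ?thesis by blast
qed

lemma path_sides_append:
  "path_sides (xs @ y # ys) = path_sides (xs @ [y]) \<union> path_sides (y # ys)"
proof (induction xs)
  case (Cons x xs)
  then show ?case by (cases xs) auto
qed simp

lemma path_sides_snoc_snoc: "path_sides (xs @ [y, z]) = insert {y, z} (path_sides (xs @ [y]))"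
  using path_sides_append[of xs y "[z]"] by simp

lemma path_sides_rev [simp]: "path_sides (rev xs) = path_sides xs"
proof (induction xs)
  case (Cons x xs)
  then show ?case
    by (cases xs) (auto simp: path_sides_snoc_snoc insert_commute)
qed simp

lemma path_sides_subset: "e \<in> path_sides xs \<Longrightarrow> e \<subseteq> set xs"
  by (auto simp: path_sides_def)

lemma finite_path_sides [simp]: "finite (path_sides xs)"
  by (rule finite_subset[of _ "Pow (set xs)"]) (auto dest: path_sides_subset)

lemma Union_path_sides: "2 \<le> length xs \<Longrightarrow> \<Union>(path_sides xs) = set xs"
proof (induction xs)
  case (Cons x xs)
  show ?case
  proof (cases xs)
    case (Cons y ys)
    then show ?thesis using Cons.IH by (cases ys) auto
  qed (use Cons.prems in simp)
qed simp

text \<open>Serves the case in \<open>gate_unique\<close> where one of two arcs of a polygon is a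
  single side: that side does not recur in the other arc.\<close>

lemma hd_last_notin_path_sides:
  assumes "distinct (a # us @ [b])" "us \<noteq> []"
  shows "{a, b} \<notin> path_sides (a # us @ [b])"
proof -
  obtain u vs where us: "us = u # vs" using assms(2) by (cases us) auto
  have "{a, b} \<noteq> {a, u}" using assms by (auto simp: us doubleton_eq_iff)
  moreover have "{a, b} \<notin> path_sides (u # vs @ [b])"
    using assms path_sides_subset[of "{a, b}" "u # vs @ [b]"] by (auto simp: us)
  ultimately show ?thesis by (simp add: us)
qed

text \<open>Repeating the first vertex at the end trades cyclic indices for ordinary ones, so that
  facts on open paths apply to loops.\<close>

lemma nth_Suc_mod_Cons:
  assumes "i < length (x # xs)"
  shows "(x # xs) ! (Suc i mod length (x # xs)) = (x # xs @ [x]) ! Suc i"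
proof (cases "Suc i = length (x # xs)")
  case True
  then show ?thesis by (simp add: nth_append)
next
  case False
  then show ?thesis using assms by (simp add: nth_append)
qed

lemma nth_Cons_snoc: "i < length (x # xs) \<Longrightarrow> (x # xs @ [x]) ! i = (x # xs) ! i"
  using nth_append[of "x # xs" "[x]" i] by simp

lemma closed_path_sides_Cons: "closed_path_sides (x # xs) = path_sides (x # xs @ [x])"
proof -
  have "closed_path_sides (x # xs) =
      {{(x # xs) ! i, (x # xs) ! (Suc i mod length (x # xs))} | i. i < length (x # xs)}"
    by (simp only: closed_path_sides_def)
  also have "\<dots> = {{(x # xs @ [x]) ! i, (x # xs @ [x]) ! Suc i} | i. i < length (x # xs)}"
    using nth_Suc_mod_Cons[of _ x xs] nth_Cons_snoc[of _ x xs] by (metis (no_types, opaque_lifting))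
  finally show ?thesis by (simp add: path_sides_def)
qed

lemma closed_path_Cons:
  "closed_path E (x # xs) \<longleftrightarrow> distinct (x # xs) \<and> successively E (x # xs @ [x])"
proof -
  have "(\<forall>i<length (x # xs). E ((x # xs) ! i) ((x # xs) ! (Suc i mod length (x # xs)))) \<longleftrightarrow>
      (\<forall>i<length (x # xs). E ((x # xs @ [x]) ! i) ((x # xs @ [x]) ! Suc i))"
    using nth_Suc_mod_Cons[of _ x xs] nth_Cons_snoc[of _ x xs] by metis
  then show ?thesis
    by (simp only: closed_path_def successively_conv_nth) simp
qed

lemma closed_path_sides_rotate: "closed_path_sides (xs @ ys) = closed_path_sides (ys @ xs)"
proof (cases "xs = [] \<or> ys = []")
  case False
  then obtain x xs' y ys' where [simp]: "xs = x # xs'" "ys = y # ys'"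
    by (meson neq_Nil_conv)
  have "closed_path_sides (xs @ ys) = path_sides (x # xs' @ [y]) \<union> path_sides (y # ys' @ [x])"
    using path_sides_append[of "x # xs'" y "ys' @ [x]"] by (simp add: closed_path_sides_Cons)
  moreover have
    "closed_path_sides (ys @ xs) = path_sides (y # ys' @ [x]) \<union> path_sides (x # xs' @ [y])"
    using path_sides_append[of "y # ys'" x "xs' @ [y]"] by (simp add: closed_path_sides_Cons)
  ultimately show ?thesis by blast
qed auto

lemma successively_split:
  "successively R (us @ v # vs) \<longleftrightarrow> successively R (us @ [v]) \<and> successively R (v # vs)"
  by (auto simp: successively_append_iff)

lemma closed_path_rotate: "closed_path E (xs @ ys) \<longleftrightarrow> closed_path E (ys @ xs)"
proof (cases "xs = [] \<or> ys = []")
  case False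
  then obtain x xs' y ys' where [simp]: "xs = x # xs'" "ys = y # ys'"
    by (meson neq_Nil_conv)
  show ?thesis
    using successively_split[of E "x # xs'" y "ys' @ [x]"]
      successively_split[of E "y # ys'" x "xs' @ [y]"]
    by (auto simp: closed_path_Cons)
qed auto

lemma closed_path_rotate_to:
  assumes "closed_path E ps" "a \<in> set ps"
  obtains qs where "closed_path E (a # qs)" "closed_path_sides (a # qs) = closed_path_sides ps"
    "length (a # qs) = length ps"
proof -
  obtain us vs where ps: "ps = us @ a # vs" using assms(2) by (meson split_list)
  show thesis
    using assms(1) that[of "vs @ us"] closed_path_rotate[of E us "a # vs"]
      closed_path_sides_rotate[of us "a # vs"] by (simp add: ps)
qed

text \<open>The first vertex of a simple path lies on at most one of its sides, whereas every vertex
  of a loop of length at least 3 lies on two sides of the loop. So the loop misses the first vertex,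
  and the rest is induction on the path.\<close>

lemma closed_path_sides_not_subset_path_sides:
  "distinct xs \<Longrightarrow> closed_path E qs \<Longrightarrow> 3 \<le> length qs \<Longrightarrow> \<not> closed_path_sides qs \<subseteq> path_sides xs"
proof (induction xs arbitrary: qs)
  case Nil
  then obtain q ps where q: "qs = q # ps" by (cases qs) auto
  have "\<exists>e. e \<in> path_sides (q # ps @ [q])" by (cases ps) auto
  then show ?case by (auto simp: q closed_path_sides_Cons)
next
  case (Cons x xs)
  show ?case
  proof
    assume sub: "closed_path_sides qs \<subseteq> path_sides (x # xs)"
    show False
    proof (cases "x \<in> set qs")
      case True
      obtain ps where ps: "closed_path E (x # ps)" "closed_path_sides (x # ps) = closed_path_sides qs"
        "length (x # ps) = length qs"
        using closed_path_rotate_to[OF Cons.prems(2) True] by blast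
      obtain y ys where ys: "ps = y # ys" "ys \<noteq> []"
        using ps(3) Cons.prems(3) by (cases ps; cases "tl ps") auto
      obtain zs z where zs: "ys = zs @ [z]" using ys(2) by (meson rev_exhaust)
      have ne: "y \<noteq> z" using ps(1) by (auto simp: ys zs closed_path_Cons)
      have "{x, y} \<in> path_sides (x # xs)" "{x, z} \<in> path_sides (x # xs)"
        using sub unfolding ps(2)[symmetric] closed_path_sides_Cons
        using path_sides_snoc_snoc[of "y # zs" z x] by (auto simp: ys zs insert_commute)
      then obtain w ws where xs: "xs = w # ws" by (cases xs) auto
      have "e = {x, w}" if "e \<in> path_sides (x # xs)" "x \<in> e" for e
        using that Cons.prems(1) path_sides_subset[of e xs] by (auto simp: xs)
      then have "{x, y} = {x, w}" "{x, z} = {x, w}"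
        using \<open>{x, y} \<in> path_sides (x # xs)\<close> \<open>{x, z} \<in> path_sides (x # xs)\<close> by blast+
      then show False using ne by (metis doubleton_eq_iff)
    next
      case False
      obtain q ps where q: "qs = q # ps" using Cons.prems(3) by (cases qs) auto
      have "closed_path_sides qs \<subseteq> path_sides xs"
      proof
        fix e assume e: "e \<in> closed_path_sides qs"
        have "x \<notin> e"
          using path_sides_subset[of e "q # ps @ [q]"] e False by (auto simp: q closed_path_sides_Cons)
        then show "e \<in> path_sides xs" using sub e by (cases xs) auto
      qed
      then show False using Cons.IH[of qs] Cons.prems by auto
    qed
  qed
qed

lemma successively_appendD: "successively R (xs @ ys) \<Longrightarrow> successively R xs"
  by (simp add: successively_append_iff)

text \<open>The path is built backwards from its end; if the new vertex already occurs, the loop is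
  cut out by restarting at that occurrence.\<close>

lemma rtranclp_imp_distinct_path:
  assumes "R\<^sup>*\<^sup>* x y"
  obtains xs where "last (x # xs) = y" "distinct (x # xs)" "successively R (x # xs)"
proof -
  have "\<exists>xs. last (x # xs) = y \<and> distinct (x # xs) \<and> successively R (x # xs)"
    using assms
  proof (induction rule: converse_rtranclp_induct)
    case base
    show ?case by (intro exI[of _ "[]"]) simp
  next
    case (step x x')
    then obtain xs where xs: "last (x' # xs) = y" "distinct (x' # xs)" "successively R (x' # xs)"
      by blast
    show ?case
    proof (cases "x \<in> set (x' # xs)")
      case True
      then obtain us vs where "x' # xs = us @ x # vs" by (meson split_list)
      then show ?thesis using xs by (intro exI[of _ vs]) (auto simp: successively_append_iff)
    next
      case False
      then show ?thesis using xs step(1) by (intro exI[of _ "x' # xs"]) auto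
    qed
  qed
  then show thesis using that by auto
qed

lemma successively_imp_rtranclp: "successively R (x # xs) \<Longrightarrow> R\<^sup>*\<^sup>* x (last (x # xs))"
proof (induction xs arbitrary: x)
  case (Cons y ys)
  then show ?case by (auto intro: converse_rtranclp_into_rtranclp)
qed simp

section \<open>Gates\<close>

locale polygonal_graph =
  fixes E :: "'v \<Rightarrow> 'v \<Rightarrow> bool" and k r :: nat
  assumes k_ge: "2 \<le> k" and r_ge: "2 \<le> r" and graph: "symmetric_graph E k r"
begin

abbreviation "Pol \<equiv> polygons E k"
abbreviation "dst \<equiv> poly_dist E k"

text \<open>For a polygon \<open>P\<close>, the classes of the reflexive transitive closure are the
  components left after deleting the sides of \<open>P\<close>; each contains exactly one vertex of
  \<open>P\<close>.\<close>

definition avoid :: "'v set set \<Rightarrow> 'v \<Rightarrow> 'v \<Rightarrow> bool" where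
  "avoid P x y \<longleftrightarrow> E x y \<and> {x, y} \<notin> P"

lemma E_sym: "E x y \<Longrightarrow> E y x"
  using graph by (auto simp: symmetric_graph_def dest: sympD)

lemma E_connected: "E\<^sup>*\<^sup>* x y"
  using graph by (simp add: symmetric_graph_def)

lemma edge_in_polygon: "E x y \<Longrightarrow> \<exists>P\<in>Pol. {x, y} \<in> P"
  using graph by (simp add: symmetric_graph_def)

lemma card_polygons_at: "card {P \<in> Pol. v \<in> \<Union>P} = r"
  using graph unfolding symmetric_graph_def by (elim conjE) (rule spec)

lemma finite_polygons_at: "finite {P \<in> Pol. v \<in> \<Union>P}"
  using card_polygons_at[of v] r_ge by (metis card.infinite not_numeral_le_zero)

lemma polygons_meet:
  assumes "P \<in> Pol" "P' \<in> Pol" "P \<noteq> P'" "v \<in> \<Union>P" "v \<in> \<Union>P'"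
  shows "P \<inter> P' = {}" "\<Union>P \<inter> \<Union>P' = {v}"
proof -
  have "\<forall>v. \<forall>P\<in>Pol. \<forall>P'\<in>Pol. P \<noteq> P' \<and> v \<in> \<Union>P \<and> v \<in> \<Union>P' \<longrightarrow> P \<inter> P' = {} \<and> \<Union>P \<inter> \<Union>P' = {v}"
    using graph unfolding symmetric_graph_def by (elim conjE)
  then have "P \<inter> P' = {} \<and> \<Union>P \<inter> \<Union>P' = {v}"
    using assms by (simp only: simp_thms)
  then show "P \<inter> P' = {}" "\<Union>P \<inter> \<Union>P' = {v}" by (rule conjunct1, rule conjunct2)
qed

lemma polygon_in_closed_path:
  assumes "closed_path E xs" "3 \<le> length xs"
  shows "3 \<le> k" "\<exists>P\<in>Pol. P \<subseteq> closed_path_sides xs"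
proof -
  have "\<forall>xs. closed_path E xs \<and> 3 \<le> length xs \<longrightarrow> k \<noteq> 2 \<and> (\<exists>P\<in>Pol. P \<subseteq> closed_path_sides xs)"
    using graph unfolding symmetric_graph_def by (elim conjE)
  then have "k \<noteq> 2" "\<exists>P\<in>Pol. P \<subseteq> closed_path_sides xs"
    using assms by blast+
  then show "3 \<le> k" "\<exists>P\<in>Pol. P \<subseteq> closed_path_sides xs"
    using k_ge by auto
qed

lemma polygonE:
  assumes "P \<in> Pol"
  obtains ps where "length ps = k" "closed_path E ps" "P = closed_path_sides ps" "\<Union>P = set ps"
proof -
  obtain ps where ps: "length ps = k" "closed_path E ps" "P = closed_path_sides ps"
    using assms by (auto simp: polygons_def)
  obtain q qs where q: "ps = q # qs" using ps(1) k_ge by (cases ps) auto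
  have "\<Union>P = set ps"
    using Union_path_sides[of "q # qs @ [q]"] by (auto simp: ps(3) q closed_path_sides_Cons)
  then show thesis using that ps by blast
qed

lemma polygon_at:
  assumes "P \<in> Pol" "a \<in> \<Union>P"
  obtains qs where "Suc (length qs) = k" "distinct (a # qs)" "successively E (a # qs @ [a])"
    "P = path_sides (a # qs @ [a])" "\<Union>P = set (a # qs)"
proof -
  obtain ps where ps: "length ps = k" "closed_path E ps" "P = closed_path_sides ps" "\<Union>P = set ps"
    using polygonE[OF assms(1)] by blast
  obtain qs where qs: "closed_path E (a # qs)" "closed_path_sides (a # qs) = P" "length (a # qs) = k"
    using closed_path_rotate_to[OF ps(2), of a] assms(2) ps by metis
  show thesis
  proof (rule that)
    show "\<Union>P = set (a # qs)"
      using Union_path_sides[of "a # qs @ [a]"] by (auto simp: qs(2)[symmetric] closed_path_sides_Cons)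
  qed (use qs in \<open>simp_all add: closed_path_Cons closed_path_sides_Cons\<close>)
qed

lemma card_polygon: "P \<in> Pol \<Longrightarrow> finite (\<Union>P) \<and> card (\<Union>P) = k"
proof -
  assume "P \<in> Pol"
  then obtain ps where ps: "length ps = k" "closed_path E ps" "\<Union>P = set ps"
    using polygonE[of P] by metis
  then show ?thesis by (simp add: closed_path_def distinct_card)
qed

lemma polygon_edge_nonempty: "P \<in> Pol \<Longrightarrow> e \<in> P \<Longrightarrow> e \<noteq> {}"
  by (auto simp: polygons_def closed_path_sides_def)

lemma polygons_disjoint:
  assumes "P \<in> Pol" "P' \<in> Pol" "P \<noteq> P'"
  shows "P \<inter> P' = {}"
proof (rule ccontr)
  assume "P \<inter> P' \<noteq> {}"
  then obtain e where e: "e \<in> P" "e \<in> P'" by blast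
  then obtain v where "v \<in> e" using polygon_edge_nonempty assms by blast
  then have "v \<in> \<Union>P" "v \<in> \<Union>P'" using e by (simp_all only: Union_iff) blast+
  then show False using polygons_meet(1)[OF assms] e by blast
qed

lemma avoid_sym: "symp (avoid P)"
  by (rule sympI) (simp add: avoid_def E_sym insert_commute)

lemma avoid_rtranclp_sym: "(avoid P)\<^sup>*\<^sup>* x y \<Longrightarrow> (avoid P)\<^sup>*\<^sup>* y x"
  using avoid_sym by (metis sympD symp_rtranclp)

lemma successively_avoid:
  "successively (avoid P) xs \<longleftrightarrow> successively E xs \<and> P \<inter> path_sides xs = {}"
proof (induction xs)
  case (Cons x xs)
  then show ?case by (cases xs) (auto simp: avoid_def)
qed simp

text \<open>
  A shortest path outside \<open>P\<close> between two of its vertices, closed up by an arc of \<open>P\<close>, would be a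
  loop containing all sides of no polygon.
\<close>
lemma gate_unique:
  assumes P: "P \<in> Pol" and ab: "a \<in> \<Union>P" "b \<in> \<Union>P" "(avoid P)\<^sup>*\<^sup>* a b"
  shows "a = b"
proof (rule ccontr)
  assume "a \<noteq> b"
  \<comment> \<open>The ends are left free to vary on \<open>P\<close>, since a path from
    \<open>a\<close> to \<open>b\<close> could meet \<open>P\<close> in between. A shortest good
    path has no inner vertex on \<open>P\<close>.\<close>
  define good where "good xs \<longleftrightarrow> distinct xs \<and> successively (avoid P) xs \<and> 2 \<le> length xs \<and>
      hd xs \<in> \<Union>P \<and> last xs \<in> \<Union>P" for xs
  have "\<exists>xs. good xs"
  proof -
    obtain xs where "last (a # xs) = b" "distinct (a # xs)" "successively (avoid P) (a # xs)"
      using rtranclp_imp_distinct_path[OF ab(3)] by metis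
    then have "good (a # xs)" using \<open>a \<noteq> b\<close> ab(1,2) unfolding good_def
      by (cases xs) (simp_all del: Union_iff)
    then show ?thesis ..
  qed
  then obtain xs where xs: "good xs" and min: "\<And>ys. good ys \<Longrightarrow> length xs \<le> length ys"
    using ex_has_least_nat[of good _ length] by blast
  obtain x ys y where xs_eq: "xs = x # ys @ [y]"
  proof -
    obtain x zs where "xs = x # zs" "zs \<noteq> []" using xs unfolding good_def by (cases xs) (auto simp: Suc_le_eq)
    then show thesis using that by (metis rev_exhaust)
  qed
  have inner: "v \<notin> \<Union>P" if "v \<in> set ys" for v
  proof
    assume v: "v \<in> \<Union>P"
    obtain us vs where "ys = us @ v # vs" using \<open>v \<in> set ys\<close> by (meson split_list)
    then have split: "xs = (x # us @ [v]) @ (vs @ [y])" by (simp add: xs_eq)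
    have "distinct ((x # us @ [v]) @ (vs @ [y]))" "successively (avoid P) ((x # us @ [v]) @ (vs @ [y]))"
      "x \<in> \<Union>P"
      using xs unfolding good_def split by (simp_all del: Union_iff)
    then have "good (x # us @ [v])"
      using v unfolding good_def successively_append_iff distinct_append by (simp del: Union_iff)
    then have "length xs \<le> length (x # us @ [v])" by (rule min)
    then show False by (simp add: split)
  qed
  have path: "successively E xs" "P \<inter> path_sides xs = {}" "distinct xs" "x \<in> \<Union>P" "y \<in> \<Union>P" "x \<noteq> y"
    using xs unfolding good_def successively_avoid by (auto simp: xs_eq)
  obtain qs where qs: "Suc (length qs) = k" "distinct (x # qs)" "successively E (x # qs @ [x])"
    "P = path_sides (x # qs @ [x])" "\<Union>P = set (x # qs)"
    using polygon_at[OF P path(4)] by blast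
  have "y \<in> set qs" using path(5,6) qs(5) by auto
  then obtain us vs where qs_eq: "qs = us @ y # vs" by (meson split_list)
  have P_eq: "P = path_sides (x # us @ [y]) \<union> path_sides (y # vs @ [x])"
    using qs(4) path_sides_append[of "x # us" y "vs @ [x]"] by (simp add: qs_eq)
  have "set ys \<inter> set (x # qs) = {}"
    using inner qs(5) by blast
  then have dist: "distinct (x # ys @ y # rev us)"
    using path(3) qs(2) by (auto simp: xs_eq qs_eq)
  have succ_arc: "successively E (y # rev us @ [x])"
  proof -
    have "successively E (x # us @ [y])"
      using qs(3) successively_appendD[of E "x # us @ [y]" "vs @ [x]"] by (simp add: qs_eq)
    moreover have "successively E (rev zs) \<longleftrightarrow> successively E zs" for zs
      using E_sym by (auto simp: successively_rev intro: successively_mono)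
    ultimately show ?thesis by (metis append_Cons rev.simps(2) rev_append rev_singleton_conv rev_rev_ident append_Nil)
  qed
  have closed: "closed_path E (x # ys @ y # rev us)"
    using dist path(1) succ_arc successively_split[of E "x # ys" y "rev us @ [x]"]
    by (simp add: closed_path_Cons xs_eq)
  have sides: "closed_path_sides (x # ys @ y # rev us) = path_sides xs \<union> path_sides (x # us @ [y])"
    using path_sides_append[of "x # ys" y "rev us @ [x]"] path_sides_rev[of "x # us @ [y]"]
    by (simp add: closed_path_sides_Cons xs_eq)
  \<comment> \<open>Otherwise the edge from \<open>x\<close> to \<open>y\<close> would be a side of
    \<open>P\<close> and also a side of a path outside \<open>P\<close>.\<close>
  have "ys \<noteq> [] \<or> us \<noteq> []"
    using path(2) P_eq by (auto simp: xs_eq)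
  then have len: "3 \<le> length (x # ys @ y # rev us)"
    by (cases ys; cases us) auto
  \<comment> \<open>A tree has no such loop, so \<open>k = 2\<close> is excluded here. Below, this
    makes the arc \<open>us\<close> nonempty when \<open>vs\<close> is empty.\<close>
  have k3: "3 \<le> k" using polygon_in_closed_path(1)[OF closed len] .
  obtain P' where P': "P' \<in> Pol" "P' \<subseteq> closed_path_sides (x # ys @ y # rev us)"
    using polygon_in_closed_path(2)[OF closed len] by blast
  show False
  proof (cases "P' = P")
    case True
    \<comment> \<open>\<open>l\<close> is the vertex before \<open>x\<close> on the arc of
      \<open>P\<close> that the loop leaves out. The side from \<open>l\<close> to \<open>x\<close>
      belongs to \<open>P\<close>, but neither to \<open>xs\<close>, which avoids \<open>P\<close>,
      nor to the arc through \<open>us\<close>.\<close>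
    obtain l where l: "{l, x} \<in> P" "l \<in> set (y # vs)" "vs = [] \<longleftrightarrow> l = y"
    proof (cases vs rule: rev_cases)
      case Nil
      then show thesis using that[of y] P_eq by simp
    next
      case (snoc ws l)
      then show thesis using that[of l] P_eq qs(2) path_sides_snoc_snoc[of "y # ws" l x]
        by (auto simp: qs_eq)
    qed
    have "{l, x} \<in> path_sides (x # us @ [y])"
      using P'(2) True l(1) path(2) sides by blast
    moreover have "{l, x} \<notin> path_sides (x # us @ [y])"
    proof (cases "vs = []")
      case True
      then have "us \<noteq> []" using k3 qs(1) by (auto simp: qs_eq)
      then show ?thesis
        using hd_last_notin_path_sides[of x us y] qs(2) l(3) True
        by (auto simp: qs_eq insert_commute)
    next
      case False
      then have "l \<in> set vs" using l(2,3) by auto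
      then show ?thesis
        using path_sides_subset[of "{l, x}" "x # us @ [y]"] qs(2) by (auto simp: qs_eq)
    qed
    ultimately show False by blast
  next
    case False
    \<comment> \<open>All sides of \<open>P'\<close> then lie on the simple path \<open>xs\<close>,
      which contains no loop.\<close>
    then have "P' \<inter> P = {}" using polygons_disjoint P P'(1) by blast
    then have "P' \<subseteq> path_sides xs" using P'(2) sides P_eq by blast
    moreover obtain ps where "length ps = k" "closed_path E ps" "P' = closed_path_sides ps"
      using polygonE[OF P'(1)] by blast
    ultimately show False
      using closed_path_sides_not_subset_path_sides[of xs E ps] path(3) k3 by simp
  qed
qed

section \<open>Distances\<close>

definition gate :: "'v set set \<Rightarrow> 'v \<Rightarrow> 'v" where
  "gate P v = (SOME a. a \<in> \<Union>P \<and> (avoid P)\<^sup>*\<^sup>* v a)"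

text \<open>Follow any path from \<open>v\<close> to a vertex of \<open>P\<close>: the start of its
  first side in \<open>P\<close>, or its end if there is no such side, is reached outside
  \<open>P\<close>.\<close>

lemma gate_exists:
  assumes "P \<in> Pol"
  shows "\<exists>a. a \<in> \<Union>P \<and> (avoid P)\<^sup>*\<^sup>* v a"
proof -
  obtain p where p: "p \<in> \<Union>P"
    using card_polygon[OF assms] k_ge by (metis card.empty ex_in_conv not_numeral_le_zero)
  show ?thesis using E_connected[of v p]
  proof (induction rule: converse_rtranclp_induct)
    case base
    show ?case using p by blast
  next
    case (step y z)
    show ?case
    proof (cases "{y, z} \<in> P")
      case True
      then have "y \<in> \<Union>P" by blast
      then show ?thesis by blast
    next
      case False
      then have "avoid P y z" using step(1) by (simp add: avoid_def)
      then show ?thesis using step(3) by (meson converse_rtranclp_into_rtranclp)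
    qed
  qed
qed

lemma gate_in:
  assumes "P \<in> Pol"
  shows "gate P v \<in> \<Union>P" "(avoid P)\<^sup>*\<^sup>* v (gate P v)"
proof -
  have "gate P v \<in> \<Union>P \<and> (avoid P)\<^sup>*\<^sup>* v (gate P v)"
    unfolding gate_def by (rule someI_ex[OF gate_exists[OF assms]])
  then show "gate P v \<in> \<Union>P" "(avoid P)\<^sup>*\<^sup>* v (gate P v)" by (rule conjunct1, rule conjunct2)
qed

lemma gate_cong:
  assumes "P \<in> Pol" "(avoid P)\<^sup>*\<^sup>* x y"
  shows "gate P x = gate P y"
proof (rule gate_unique[OF assms(1) gate_in(1)[OF assms(1)] gate_in(1)[OF assms(1)]])
  show "(avoid P)\<^sup>*\<^sup>* (gate P x) (gate P y)"
    using avoid_rtranclp_sym[OF gate_in(2)[OF assms(1), of x]] assms(2)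
      gate_in(2)[OF assms(1), of y] by (meson rtranclp_trans)
qed

lemma gate_self: "P \<in> Pol \<Longrightarrow> x \<in> \<Union>P \<Longrightarrow> gate P x = x"
  using gate_unique[of P x "gate P x"] gate_in[of P x] by (simp del: Union_iff)

lemma gate_edge: "P \<in> Pol \<Longrightarrow> E x y \<Longrightarrow> {x, y} \<notin> P \<Longrightarrow> gate P x = gate P y"
  by (intro gate_cong) (auto simp: avoid_def)

lemma gate_path:
  assumes "P \<in> Pol" "successively E (x # xs)" "P \<inter> path_sides (x # xs) = {}"
  shows "gate P x = gate P (last (x # xs))"
  using assms by (intro gate_cong successively_imp_rtranclp) (simp_all add: successively_avoid)

section \<open>Separating polygons, and the distance as their number\<close>

definition sep :: "'v \<Rightarrow> 'v \<Rightarrow> 'v set set set" where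
  "sep x y = {P \<in> Pol. gate P x \<noteq> gate P y}"

text \<open>The far end of the last side in \<open>P\<close> is joined to the end of the path
  outside \<open>P\<close>, so it is the gate; as the far end of a side it is not the initial entry
  of the list. \<open>gate_hd_in\<close> is the counterpart for the first side.\<close>

lemma gate_last_in_tl:
  assumes "P \<in> Pol"
  shows "successively E (x # xs) \<Longrightarrow> P \<inter> path_sides (x # xs) \<noteq> {} \<Longrightarrow>
    gate P (last (x # xs)) \<in> set xs"
proof (induction xs arbitrary: x)
  case (Cons y zs)
  show ?case
  proof (cases "P \<inter> path_sides (y # zs) = {}")
    case True
    then have "{x, y} \<in> P" using Cons.prems(2) by simp
    then have "y \<in> \<Union>P" by blast
    then show ?thesis using gate_path[OF assms _ True] gate_self[OF assms, of y] Cons.prems(1)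
      by simp
  next
    case False
    then show ?thesis using Cons.IH[of y] Cons.prems(1) by simp
  qed
qed simp

lemma gate_hd_in:
  assumes "P \<in> Pol"
  shows "successively E (x # xs) \<Longrightarrow> P \<inter> path_sides (x # xs) \<noteq> {} \<Longrightarrow> gate P x \<in> set (x # xs)"
proof (induction xs arbitrary: x)
  case (Cons y zs)
  show ?case
  proof (cases "{x, y} \<in> P")
    case True
    then have "x \<in> \<Union>P" by blast
    then show ?thesis using gate_self[OF assms, of x] by simp
  next
    case False
    then show ?thesis using Cons.IH[of y] Cons.prems gate_edge[OF assms, of x y] by simp
  qed
qed simp

text \<open>Up to its first side in \<open>P\<close> the path keeps the gate of \<open>x\<close>,
  which is the start of that side. The gate of the end occurs later in the list, and the entries are
  distinct.\<close>

lemma gate_ne_if_crossed: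
  assumes "P \<in> Pol"
  shows "distinct (x # xs) \<Longrightarrow> successively E (x # xs) \<Longrightarrow> P \<inter> path_sides (x # xs) \<noteq> {} \<Longrightarrow>
    gate P x \<noteq> gate P (last (x # xs))"
proof (induction xs arbitrary: x)
  case (Cons y zs)
  show ?case
  proof (cases "{x, y} \<in> P")
    case True
    then have "x \<in> \<Union>P" by blast
    then have "gate P x = x" using gate_self[OF assms] by simp
    moreover have "gate P (last (x # y # zs)) \<in> set (y # zs)"
      by (rule gate_last_in_tl[OF assms]) (use Cons.prems in auto)
    ultimately show ?thesis using Cons.prems(1) by auto
  next
    case False
    then show ?thesis using Cons.IH[of y] Cons.prems gate_edge[OF assms, of x y] by simp
  qed
qed simp

text \<open>All simple paths between two vertices thus cross the same polygons. An arbitrary path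
  crosses at least these, so every simple path realizes the distance.\<close>

lemma crossed_polygons_distinct:
  assumes "distinct (x # xs)" "successively E (x # xs)"
  shows "crossed_polygons E k (x # xs) = sep x (last (x # xs))"
  using gate_ne_if_crossed[OF _ assms] gate_path[OF _ assms(2)]
  unfolding crossed_polygons_def sep_def by blast

lemma sep_subset_crossed_polygons:
  "successively E (x # xs) \<Longrightarrow> sep x (last (x # xs)) \<subseteq> crossed_polygons E k (x # xs)"
  using gate_path unfolding crossed_polygons_def sep_def by blast

lemma finite_crossed_polygons: "finite (crossed_polygons E k xs)"
proof (rule finite_subset)
  show "crossed_polygons E k xs \<subseteq> (\<Union>v\<in>set xs. {P \<in> Pol. v \<in> \<Union>P})"
  proof
    fix P assume "P \<in> crossed_polygons E k xs"
    then obtain e where e: "P \<in> Pol" "e \<in> P" "e \<in> path_sides xs"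
      by (auto simp: crossed_polygons_def)
    then obtain v where "v \<in> e" using polygon_edge_nonempty by blast
    moreover have "v \<in> set xs" using path_sides_subset[OF e(3)] \<open>v \<in> e\<close> by blast
    moreover have "v \<in> \<Union>P" using \<open>v \<in> e\<close> e(2) by blast
    ultimately show "P \<in> (\<Union>v\<in>set xs. {P \<in> Pol. v \<in> \<Union>P})" using e(1) by blast
  qed
qed (intro finite_UN_I finite_set finite_polygons_at)

lemma simple_path:
  obtains xs where "last (x # xs) = y" "distinct (x # xs)" "successively E (x # xs)"
    "crossed_polygons E k (x # xs) = sep x y"
  using rtranclp_imp_distinct_path[OF E_connected[of x y]] crossed_polygons_distinct by metis

lemma finite_sep: "finite (sep x y)"
  using simple_path[of x y] finite_crossed_polygons by metis

lemma poly_dist_eq: "dst x y = card (sep x y)"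
  unfolding poly_dist_def
proof (rule Least_equality)
  obtain xs where xs: "last (x # xs) = y" "distinct (x # xs)" "successively E (x # xs)"
    "crossed_polygons E k (x # xs) = sep x y" by (rule simple_path)
  then show "\<exists>xs. xs \<noteq> [] \<and> hd xs = x \<and> last xs = y \<and> successively E xs \<and>
      card (crossed_polygons E k xs) = card (sep x y)"
    by (intro exI[of _ "x # xs"]) simp
next
  fix n assume "\<exists>xs. xs \<noteq> [] \<and> hd xs = x \<and> last xs = y \<and> successively E xs \<and>
      card (crossed_polygons E k xs) = n"
  then obtain xs where xs: "xs \<noteq> []" "hd xs = x" "last xs = y" "successively E xs"
      "card (crossed_polygons E k xs) = n" by blast
  then obtain ys where "xs = x # ys" by (cases xs) auto
  then show "card (sep x y) \<le> n"
    using card_mono[OF finite_crossed_polygons sep_subset_crossed_polygons[of x ys]] xs by simp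
qed

lemma poly_dist_sym: "dst x y = dst y x"
  unfolding poly_dist_eq sep_def by (simp add: eq_commute)

lemma poly_dist_triangle: "dst x z \<le> dst x y + dst y z"
proof -
  have "sep x z \<subseteq> sep x y \<union> sep y z" by (auto simp: sep_def)
  then have "card (sep x z) \<le> card (sep x y \<union> sep y z)" by (simp add: card_mono finite_sep)
  then show ?thesis unfolding poly_dist_eq using card_Un_le le_trans by blast
qed

lemma poly_dist_refl [simp]: "dst x x = 0"
  by (simp add: poly_dist_eq sep_def)

text \<open>\<open>P0\<close> is the first polygon on the way from \<open>x\<close> to \<open>z\<close>.\<close>
lemma exit_polygon:
  assumes "x \<noteq> z"
  obtains P0 where "P0 \<in> Pol" "x \<in> \<Union>P0" "gate P0 z \<noteq> x"
    "\<And>P. P \<in> Pol \<Longrightarrow> x \<in> \<Union>P \<Longrightarrow> P \<noteq> P0 \<Longrightarrow> gate P z = x"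
proof -
  obtain xs where xs: "last (x # xs) = z" "distinct (x # xs)" "successively E (x # xs)"
    "crossed_polygons E k (x # xs) = sep x z" by (rule simple_path)
  then obtain y zs where xs_eq: "xs = y # zs" using assms by (cases xs) auto
  then obtain P0 where P0: "P0 \<in> Pol" "{x, y} \<in> P0"
    using edge_in_polygon[of x y] xs(3) by auto
  have x: "x \<in> \<Union>P0" using P0(2) by blast
  have "P0 \<in> sep x z" using P0 xs(4) unfolding crossed_polygons_def by (auto simp: xs_eq)
  then have "gate P0 z \<noteq> x" using gate_self[OF P0(1) x] by (simp add: sep_def eq_commute[of x])
  moreover have "gate P z = x" if P: "P \<in> Pol" "x \<in> \<Union>P" "P \<noteq> P0" for P
  proof (rule ccontr)
    assume "gate P z \<noteq> x"
    then have "P \<in> sep x z" using gate_self[OF P(1,2)] P(1) by (simp add: sep_def eq_commute[of x])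
    then have "P \<inter> path_sides (x # xs) \<noteq> {}" using xs(4) by (auto simp: crossed_polygons_def)
    moreover have notin: "{x, y} \<notin> P" using polygons_disjoint[OF P(1) P0(1) P(3)] P0(2) by blast
    ultimately have "P \<inter> path_sides (y # zs) \<noteq> {}" by (simp add: xs_eq)
    then have "gate P y \<in> set (y # zs)"
      by (intro gate_hd_in[OF P(1)]) (use xs(3) in \<open>simp_all add: xs_eq\<close>)
    moreover have "gate P y = x"
      using gate_edge[OF P(1) _ notin] gate_self[OF P(1,2)] xs(3) by (simp add: xs_eq)
    ultimately show False using xs(2) by (simp add: xs_eq)
  qed
  ultimately show thesis using that P0(1) x by blast
qed

text \<open>An arc of \<open>P\<close> from \<open>x\<close> to \<open>y\<close> has no side in
  \<open>P'\<close>, so \<open>x\<close> and \<open>y\<close> lie in the same component outside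
  \<open>P'\<close>.\<close>

lemma gate_same_polygon:
  assumes P: "P \<in> Pol" "P' \<in> Pol" "P' \<noteq> P" "x \<in> \<Union>P" "y \<in> \<Union>P"
  shows "gate P' x = gate P' y"
proof (cases "x = y")
  case False
  obtain qs where qs: "successively E (x # qs @ [x])" "P = path_sides (x # qs @ [x])"
    "\<Union>P = set (x # qs)"
    using polygon_at[OF P(1,4)] by metis
  have "y \<in> set qs" using P(5) False unfolding qs(3) by simp
  then obtain us vs where us: "qs = us @ y # vs" by (meson split_list)
  have "path_sides (x # us @ [y]) \<subseteq> P"
    using qs(2) path_sides_append[of "x # us" y "vs @ [x]"] by (simp add: us)
  then have "P' \<inter> path_sides (x # us @ [y]) = {}"
    using polygons_disjoint[OF P(2,1,3)] by blast
  moreover have "successively E (x # us @ [y])"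
    using qs(1) successively_appendD[of E "x # us @ [y]" "vs @ [x]"] by (simp add: us)
  ultimately show ?thesis using gate_path[OF P(2), of x "us @ [y]"] by simp
qed simp

lemma sep_same_polygon:
  assumes "P \<in> Pol" "x \<in> \<Union>P" "y \<in> \<Union>P"
  shows "sep y z - {P} = sep x z - {P}"
proof -
  have "P' \<in> sep y z \<longleftrightarrow> P' \<in> sep x z" if "P' \<noteq> P" for P'
    using gate_same_polygon[OF assms(1) _ that assms(2,3)] by (auto simp: sep_def)
  then show ?thesis by blast
qed

lemma in_sep_iff: "P \<in> Pol \<Longrightarrow> x \<in> \<Union>P \<Longrightarrow> P \<in> sep x z \<longleftrightarrow> gate P z \<noteq> x"
  using gate_self[of P x] by (simp add: sep_def eq_commute[of x] del: Union_iff)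

text \<open>Inside \<open>P\<close> only the contribution of \<open>P\<close> itself can change: it
  is 0 at the gate of \<open>z\<close> and 1 at all other vertices of \<open>P\<close>. The additive
  form avoids subtraction of natural numbers.\<close>

lemma poly_dist_same_polygon:
  assumes "P \<in> Pol" "x \<in> \<Union>P" "y \<in> \<Union>P"
  shows "dst y z + (if gate P z \<noteq> x then 1 else 0) = dst x z + (if gate P z \<noteq> y then 1 else 0)"
proof -
  have *: "card (sep v z) = card (sep v z - {P}) + (if gate P z \<noteq> v then 1 else 0)" if "v \<in> \<Union>P" for v
  proof (cases "gate P z \<noteq> v")
    case True
    then have "P \<in> sep v z" using in_sep_iff[OF assms(1) that] by simp
    then show ?thesis using True card_Suc_Diff1[OF finite_sep, of P v z] by simp
  next
    case False
    then show ?thesis using in_sep_iff[OF assms(1) that, of z] by simp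
  qed
  show ?thesis unfolding poly_dist_eq
    using *[OF assms(2)] *[OF assms(3)] sep_same_polygon[OF assms, of z] by simp
qed

text \<open>Neighbours need not be adjacent in \<open>E\<close>, since crossing a polygon along
  several sides costs 1. Conversely, if \<open>P\<close> alone separates two vertices, every side of
  a simple path between them lies in a crossed polygon, that is in \<open>P\<close>.\<close>

lemma poly_dist_eq_1_iff: "dst y x = 1 \<longleftrightarrow> x \<noteq> y \<and> (\<exists>P\<in>Pol. x \<in> \<Union>P \<and> y \<in> \<Union>P)"
proof
  assume "dst y x = 1"
  then obtain P where P: "sep y x = {P}" by (auto simp: poly_dist_eq card_1_singleton_iff)
  obtain xs where xs: "last (y # xs) = x" "distinct (y # xs)" "successively E (y # xs)"
    "crossed_polygons E k (y # xs) = sep y x" by (rule simple_path)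
  have "x \<noteq> y" using \<open>dst y x = 1\<close> by auto
  then have len: "2 \<le> length (y # xs)" using xs(1) by (cases xs) auto
  have "P \<in> Pol" using P by (auto simp: sep_def)
  have "e \<in> P" if e: "e \<in> path_sides (y # xs)" for e
  proof -
    obtain u v where "e = {u, v}" "E u v"
      using e xs(3) by (auto simp: path_sides_def successively_conv_nth)
    then obtain P' where "P' \<in> Pol" "e \<in> P'" using edge_in_polygon by blast
    then have "P' \<in> crossed_polygons E k (y # xs)" using e by (auto simp: crossed_polygons_def)
    then show ?thesis using xs(4) P \<open>e \<in> P'\<close> by simp
  qed
  then have "set (y # xs) \<subseteq> \<Union>P" using Union_path_sides[OF len] by blast
  moreover have "x \<in> set (y # xs)" using xs(1) last_in_set by blast
  ultimately show "x \<noteq> y \<and> (\<exists>P\<in>Pol. x \<in> \<Union>P \<and> y \<in> \<Union>P)"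
    using \<open>x \<noteq> y\<close> \<open>P \<in> Pol\<close> by (metis list.set_intros(1) subsetD)
next
  assume "x \<noteq> y \<and> (\<exists>P\<in>Pol. x \<in> \<Union>P \<and> y \<in> \<Union>P)"
  then obtain P where P: "P \<in> Pol" "x \<in> \<Union>P" "y \<in> \<Union>P" "x \<noteq> y" by blast
  then show "dst y x = 1"
    using poly_dist_same_polygon[OF P(1-3), of x] gate_self[OF P(1,2)] by simp
qed

lemma poly_dist_eq_0_iff [simp]: "dst x y = 0 \<longleftrightarrow> x = y"
proof
  assume "dst x y = 0"
  then have sep: "sep x y = {}" by (simp add: poly_dist_eq finite_sep)
  show "x = y"
  proof (rule ccontr)
    assume "x \<noteq> y"
    then obtain P where "P \<in> Pol" "x \<in> \<Union>P" "gate P y \<noteq> x" by (rule exit_polygon)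
    then show False using sep in_sep_iff[of P x y] by simp
  qed
qed simp

section \<open>Counting neighbours by their distance from a vertex\<close>

lemma neighbours_eq: "{y. dst y x = 1} = (\<Union>P\<in>{P \<in> Pol. x \<in> \<Union>P}. \<Union>P - {x})"
proof -
  define V :: "'v set set \<Rightarrow> 'v set" where "V = Union"
  have "dst y x = 1 \<longleftrightarrow> x \<noteq> y \<and> (\<exists>P\<in>Pol. x \<in> V P \<and> y \<in> V P)" for y
    by (simp only: V_def poly_dist_eq_1_iff)
  then have "{y. dst y x = 1} = (\<Union>P\<in>{P \<in> Pol. x \<in> V P}. V P - {x})" by blast
  then show ?thesis by (simp only: V_def)
qed

text \<open>Polygons at \<open>x\<close> meet only in \<open>x\<close>, so they contribute disjoint
  sets of \<open>k - 1\<close> vertices. The family is arbitrary because the lemma is applied to all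
  \<open>r\<close> polygons at \<open>x\<close> and to all but the exit polygon.\<close>

lemma card_neighbours_in:
  assumes "\<P> \<subseteq> {P \<in> Pol. x \<in> \<Union>P}"
  shows "finite (\<Union>P\<in>\<P>. \<Union>P - {x})" "card (\<Union>P\<in>\<P>. \<Union>P - {x}) = card \<P> * (k - 1)"
proof -
  define V :: "'v set set \<Rightarrow> 'v set" where "V = Union"
  have fin: "finite \<P>" using assms finite_polygons_at finite_subset by blast
  have sub: "P \<in> Pol \<and> x \<in> V P" if "P \<in> \<P>" for P
    using assms that unfolding V_def by blast
  then have V: "finite (V P - {x}) \<and> card (V P - {x}) = k - 1" if "P \<in> \<P>" for P
    using card_polygon[of P] that unfolding V_def[symmetric] by (metis card_Diff_singleton finite_Diff)
  have disj: "(V P - {x}) \<inter> (V P' - {x}) = {}" if "P \<in> \<P>" "P' \<in> \<P>" "P \<noteq> P'" for P P'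
  proof -
    have "V P \<inter> V P' = {x}"
      using polygons_meet(2)[of P P' x] sub that unfolding V_def[symmetric] by blast
    then show ?thesis by blast
  qed
  have "finite (\<Union>P\<in>\<P>. V P - {x})" using fin V by blast
  then show "finite (\<Union>P\<in>\<P>. \<Union>P - {x})" by (simp only: V_def)
  have "card (\<Union>P\<in>\<P>. V P - {x}) = (\<Sum>P\<in>\<P>. card (V P - {x}))"
    by (rule card_UN_disjoint) (use fin V disj in blast)+
  then have "card (\<Union>P\<in>\<P>. V P - {x}) = card \<P> * (k - 1)" using V by simp
  then show "card (\<Union>P\<in>\<P>. \<Union>P - {x}) = card \<P> * (k - 1)" by (simp only: V_def)
qed

lemma finite_neighbours: "finite {y. dst y x = 1}"
  and card_neighbours: "card {y. dst y x = 1} = r * (k - 1)"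
  unfolding neighbours_eq using card_neighbours_in[OF subset_refl] card_polygons_at by simp_all

text \<open>Among the polygons at \<open>x\<close> only the exit polygon \<open>P0\<close> leads
  towards \<open>z\<close>. Its gate \<open>g\<close> is one step closer, its remaining
  \<open>k - 2\<close> vertices are as far as \<open>x\<close>, and every step into one of the other
  \<open>r - 1\<close> polygons leads away from \<open>z\<close>.\<close>

lemma card_neighbours_by_distance:
  assumes "x \<noteq> z"
  shows "card {y. dst y x = 1 \<and> Suc (dst y z) = dst x z} = 1"
    and "card {y. dst y x = 1 \<and> dst y z = dst x z} = k - 2"
    and "card {y. dst y x = 1 \<and> dst y z = Suc (dst x z)} = (r - 1) * (k - 1)"
proof -
  define V :: "'v set set \<Rightarrow> 'v set" where "V = Union"
  define A where "A = {P \<in> Pol. x \<in> V P}"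
  obtain P0 where P0: "P0 \<in> Pol" "x \<in> V P0" "gate P0 z \<noteq> x"
    and others: "\<And>P. P \<in> Pol \<Longrightarrow> x \<in> V P \<Longrightarrow> P \<noteq> P0 \<Longrightarrow> gate P z = x"
    unfolding V_def using exit_polygon[OF assms] by metis
  have gV: "gate P0 z \<in> V P0" using gate_in(1)[OF P0(1)] by (simp only: V_def)
  define g where "g = gate P0 z"
  have nb: "dst y x = 1 \<longleftrightarrow> y \<noteq> x \<and> (\<exists>P\<in>A. y \<in> V P)" for y
    using poly_dist_eq_1_iff[of y x] unfolding V_def[symmetric] A_def by blast
  have in_P0: "Suc (dst y z) = dst x z + (if g \<noteq> y then 1 else 0)" if "y \<in> V P0" for y
    using poly_dist_same_polygon[OF P0(1), of x y z] P0 that unfolding V_def[symmetric] g_def by simp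
  have off_P0: "dst y z = Suc (dst x z)" if "P \<in> A" "P \<noteq> P0" "y \<in> V P" "y \<noteq> x" for P y
    using poly_dist_same_polygon[of P x y z] others[of P] that unfolding V_def[symmetric] A_def by simp
  have A: "P0 \<in> A" using P0 by (simp add: A_def)
  have g: "g \<in> V P0" "g \<noteq> x" using gV P0 by (simp_all add: g_def)
  have "{y. dst y x = 1 \<and> Suc (dst y z) = dst x z} = {g}"
    unfolding nb using in_P0 off_P0 A g by (auto split: if_splits) fastforce+
  then show "card {y. dst y x = 1 \<and> Suc (dst y z) = dst x z} = 1" by simp
  have "{y. dst y x = 1 \<and> dst y z = dst x z} = V P0 - {x, g}"
    unfolding nb using in_P0 off_P0 A g by (auto split: if_splits) fastforce+
  moreover have "card (V P0 - {x, g}) = k - 2"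
    using card_polygon[OF P0(1)] P0(2) g unfolding V_def[symmetric] by (simp add: card_Diff_subset)
  ultimately show "card {y. dst y x = 1 \<and> dst y z = dst x z} = k - 2" by simp
  have near_P0: "dst y z \<noteq> Suc (dst x z)" if "y \<in> V P0" for y
    using in_P0[OF that] by (auto split: if_splits)
  have "{y. dst y x = 1 \<and> dst y z = Suc (dst x z)} = (\<Union>P\<in>A - {P0}. V P - {x})"
    unfolding nb using near_P0 off_P0 by blast
  moreover have "card (A - {P0}) = r - 1"
    using card_polygons_at[of x] finite_polygons_at[of x] A unfolding V_def[symmetric] A_def[symmetric]
    by simp
  moreover have "A - {P0} \<subseteq> {P \<in> Pol. x \<in> \<Union>P}" by (auto simp: A_def V_def simp del: Union_iff)
  ultimately show "card {y. dst y x = 1 \<and> dst y z = Suc (dst x z)} = (r - 1) * (k - 1)"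
    using card_neighbours_in(2)[of "A - {P0}" x] unfolding V_def by simp
qed

section \<open>Horocycles\<close>

definition Q :: real where "Q = (real r - 1) * (real k - 1)"

lemma Q_ge_1: "1 \<le> Q"
  using k_ge r_ge mult_mono[of 1 "real r - 1" 1 "real k - 1"] by (simp add: Q_def)

text \<open>Every vertex other than \<open>z\<close> has a neighbour closer to \<open>z\<close>, so
  each sphere is covered by the neighbours of the preceding one.\<close>

lemma finite_sphere: "finite {x. dst x z = n}"
proof (induction n)
  case 0
  have "{x. dst x z = 0} = {z}" by auto
  then show ?case by simp
next
  case (Suc n)
  have "{x. dst x z = Suc n} \<subseteq> (\<Union>y\<in>{y. dst y z = n}. {x. dst x y = 1})"
  proof
    fix x assume "x \<in> {x. dst x z = Suc n}"
    then have x: "dst x z = Suc n" "x \<noteq> z" by auto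
    have "{y. dst y x = 1 \<and> Suc (dst y z) = dst x z} \<noteq> {}"
      using card_neighbours_by_distance(1)[OF x(2)] by (metis card.empty zero_neq_one)
    then obtain y where "dst y x = 1" "Suc (dst y z) = dst x z" by blast
    then show "x \<in> (\<Union>y\<in>{y. dst y z = n}. {x. dst x y = 1})"
      using x poly_dist_sym[of x y] by auto
  qed
  moreover have "finite (\<Union>y\<in>{y. dst y z = n}. {x. dst x y = 1})"
    by (rule finite_UN_I[OF Suc finite_neighbours])
  ultimately show ?case by (rule finite_subset)
qed

text \<open>
  The value at \<open>1\<close> counts the steps from distance \<open>0\<close> to distance \<open>1\<close>: all neighbours of a vertex are
  at distance \<open>1\<close> from it.
\<close>
definition out_degree :: "nat \<Rightarrow> real" where
  "out_degree i = (if i = 1 then real r * (real k - 1) else Q)"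

text \<open>The three indicators exclude each other. For \<open>i = 0\<close> and
  \<open>x = z\<close> the middle one would give \<open>k - 2\<close>, although \<open>z\<close> is
  not its own neighbour; hence the restriction on \<open>i\<close>.\<close>

lemma card_neighbours_at_distance:
  assumes "1 \<le> i"
  shows "real (card {y. dst y x = 1 \<and> dst y z = i}) =
    of_bool (dst x z = Suc i) + (real k - 2) * of_bool (dst x z = i) +
    out_degree i * of_bool (Suc (dst x z) = i)"
proof (cases "x = z")
  case True
  have "{y. dst y x = 1 \<and> dst y x = i} = (if i = 1 then {y. dst y x = 1} else {})" by auto
  then show ?thesis
    using True assms card_neighbours[of x] k_ge by (auto simp: out_degree_def)
next
  case False
  have nz: "dst x z \<noteq> 0" using False by simp
  have near: "dst x z \<le> Suc (dst y z) \<and> dst y z \<le> Suc (dst x z)" if "dst y x = 1" for y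
    using poly_dist_triangle[of x z y] poly_dist_triangle[of y z x] that poly_dist_sym[of x y] by simp
  consider "dst x z = Suc i" | "dst x z = i" | "Suc (dst x z) = i"
    | "dst x z \<noteq> Suc i" "dst x z \<noteq> i" "Suc (dst x z) \<noteq> i" by blast
  then show ?thesis
  proof cases
    case 1
    then show ?thesis using card_neighbours_by_distance(1)[OF False] by simp
  next
    case 2
    then show ?thesis using card_neighbours_by_distance(2)[OF False] k_ge by (simp add: of_nat_diff)
  next
    case 3
    then have "i \<noteq> 1" using nz by linarith
    then show ?thesis
      using 3 card_neighbours_by_distance(3)[OF False] k_ge r_ge
      by (simp add: of_nat_diff out_degree_def Q_def)
  next
    case 4
    then have "\<not> (dst y x = 1 \<and> dst y z = i)" for y using near[of y] by linarith
    then have "{y. dst y x = 1 \<and> dst y z = i} = {}" by blast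
    then have "card {y. dst y x = 1 \<and> dst y z = i} = 0" by (simp only: card.empty)
    then show ?thesis using 4 by (simp del: One_nat_def)
  qed
qed

section \<open>Intersections of two spheres and the wave equation\<close>

definition joint_count :: "'v \<Rightarrow> 'v \<Rightarrow> nat \<Rightarrow> nat \<Rightarrow> real" where
  "joint_count u z n i = real (card {x. dst x u = n \<and> dst x z = i})"

lemma joint_count_commute: "joint_count u z n i = joint_count z u i n"
  unfolding joint_count_def by (simp add: conj_commute)

lemma sum_neighbours_at_distance:
  assumes "1 \<le> i"
  shows "(\<Sum>x | dst x u = n. real (card {y. dst y x = 1 \<and> dst y z = i})) =
    joint_count u z n (Suc i) + (real k - 2) * joint_count u z n i +
    out_degree i * joint_count u z n (i - 1)"
proof -
  have count: "(\<Sum>x | dst x u = n. of_bool (dst x z = j)) = joint_count u z n j" for j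
    using sum.inter_filter[OF finite_sphere[of u n], of "\<lambda>_. 1 :: real" "\<lambda>x. dst x z = j"]
    by (simp add: joint_count_def of_bool_def)
  have "Suc (dst x z) = i \<longleftrightarrow> dst x z = i - 1" for x using assms by auto
  then show ?thesis
    by (simp add: card_neighbours_at_distance[OF assms] sum.distrib sum_distrib_left[symmetric] count
        del: One_nat_def)
qed

text \<open>
  With \<open>(k - 2) joint_count u z n i\<close> added, both sides count the pairs of neighbours \<open>x\<close>, \<open>y\<close> with
  \<open>d(x,u) = n\<close> and \<open>d(y,z) = i\<close>.
\<close>
lemma joint_count_recurrence:
  assumes "1 \<le> n" "1 \<le> i"
  shows "joint_count u z (Suc n) i + out_degree n * joint_count u z (n - 1) i =
    joint_count u z n (Suc i) + out_degree i * joint_count u z n (i - 1)"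
proof -
  have swap: "(\<Sum>x | dst x u = n. real (card {y. dst y x = 1 \<and> dst y z = i})) =
      (\<Sum>y | dst y z = i. real (card {x. dst x y = 1 \<and> dst x u = n}))"
    using sum.swap_restrict[OF finite_sphere[of u n] finite_sphere[of z i],
        of "\<lambda>_ _. 1 :: real" "\<lambda>x y. dst y x = 1"] poly_dist_sym
    by (simp add: conj_commute)
  show ?thesis
    using swap sum_neighbours_at_distance[OF assms(2), where u = u and n = n and z = z]
      sum_neighbours_at_distance[OF assms(1), where u = z and n = i and z = u]
    by (simp add: joint_count_commute[of z u])
qed

text \<open>The explicit formula for the Abel transform at \<open>h\<close> has the coefficient
  \<open>Q powr (n / 2) * abel_coeff n h\<close> in front of \<open>f(n)\<close>; the odd terms of
  that formula carry one factor \<open>sqrt Q\<close> less, whence the quotient.\<close>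

definition abel_coeff :: "nat \<Rightarrow> int \<Rightarrow> real" where
  "abel_coeff n h =
     (if int n = \<bar>h\<bar> then 1 else if int n < \<bar>h\<bar> then 0
      else if odd (int n - h) then (real k - 2) / sqrt Q else (real r - 2) / (real r - 1))"

lemma abel_coeff_minus: "abel_coeff n (- h) = abel_coeff n h"
  by (simp add: abel_coeff_def)

lemma abel_coeff_eq_0: "int n < \<bar>h\<bar> \<Longrightarrow> abel_coeff n h = 0"
  by (simp add: abel_coeff_def)

lemma abel_coeff_recurrence:
  assumes "1 \<le> n"
  shows "abel_coeff (Suc n) h + out_degree n / Q * abel_coeff (n - 1) h =
    abel_coeff n (h - 1) + abel_coeff n (h + 1)"
proof -
  have nonneg: "abel_coeff (Suc n) h + out_degree n / Q * abel_coeff (n - 1) h =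
      abel_coeff n (h - 1) + abel_coeff n (h + 1)" if h0: "0 \<le> h" for h :: int
  proof -
    define a b where "a = (real k - 2) / sqrt Q" and "b = (real r - 2) / (real r - 1)"
    \<comment> \<open>For \<open>n = 1\<close> the weight is \<open>r / (r - 1) = 2 - b\<close>. It
      only matters at \<open>h = 0\<close>, where it balances the equation:
      \<open>b + (2 - b) = 1 + 1\<close>.\<close>
    have w: "out_degree n / Q = (if n = 1 then 2 - b else 1)"
      using Q_ge_1 k_ge r_ge by (auto simp: out_degree_def b_def Q_def field_simps)
    have c: "abel_coeff m (int j) = (if m = j then 1 else if m < j then 0 else if odd (m + j) then a else b)"
      for m j
    proof -
      have "odd (int m - int j) \<longleftrightarrow> odd (int (m + j))" by simp
      then show ?thesis unfolding even_of_nat by (auto simp: abel_coeff_def a_def b_def)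
    qed
    obtain m where m: "n = Suc m" using assms by (cases n) auto
    obtain j where j: "h = int j" using h0 nonneg_int_cases by blast
    show ?thesis
    proof (cases j)
      case 0
      have "abel_coeff n (h - 1) = abel_coeff n (int 1)" "abel_coeff n (h + 1) = abel_coeff n (int 1)"
        using abel_coeff_minus[of n 1] by (simp_all add: j 0)
      then show ?thesis unfolding w j unfolding 0 by (simp only: c) (auto simp: m)
    next
      case (Suc i)
      then have "abel_coeff n (h - 1) = abel_coeff n (int i)"
        "abel_coeff n (h + 1) = abel_coeff n (int (Suc (Suc i)))" by (simp_all add: j add.commute)
      then show ?thesis unfolding w j unfolding Suc by (simp only: c) (auto simp: m)
    qed
  qed
  show ?thesis
  proof (cases "0 \<le> h")
    case False
    have "- h - 1 = - (h + 1)" "- h + 1 = - (h - 1)" by simp_all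
    then have "abel_coeff n (- h - 1) = abel_coeff n (h + 1)"
      "abel_coeff n (- h + 1) = abel_coeff n (h - 1)"
      by (simp_all only: abel_coeff_minus)
    then show ?thesis using nonneg[of "- h"] False by (simp add: abel_coeff_minus del: One_nat_def)
  qed (rule nonneg)
qed

text \<open>Both sides solve the same two-step recurrence in \<open>n\<close>, so the values at
  \<open>n = 0\<close> and \<open>n = 1\<close> and the boundary values at \<open>i = 0\<close>
  suffice. The hypothesis keeps the sphere about \<open>u\<close> from reaching \<open>z\<close>,
  which makes these boundary values 0.\<close>

lemma joint_count_eq:
  assumes "n < dst u z"
  shows "joint_count u z n i =
    Q powr ((real n - real (dst u z) + real i) / 2) * abel_coeff n (int (dst u z) - int i)"
  using assms
proof (induction n arbitrary: i rule: less_induct)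
  case (less n)
  define t where "t = dst u z"
  define F where "F n i = Q powr ((real n - real t + real i) / 2) * abel_coeff n (int t - int i)" for n i
  have Q: "Q > 0" using Q_ge_1 by linarith
  have nt: "n < t" using less.prems by (simp add: t_def)
  have IH: "joint_count u z m j = F m j" if "m < n" for m j
    using less.IH[OF that] that less.prems by (simp add: F_def t_def)
  have zero: "joint_count u z m 0 = 0" "F m 0 = 0" if "m < t" for m
  proof -
    have "{x. dst x u = m \<and> dst x z = 0} = {}"
      using that poly_dist_sym[of u z] by (auto simp: t_def)
    then show "joint_count u z m 0 = 0" by (simp add: joint_count_def)
    show "F m 0 = 0" using that by (simp add: F_def abel_coeff_eq_0)
  qed
  have "joint_count u z n i = F n i"
  proof (cases "i = 0")
    case True
    then show ?thesis using zero nt by simp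
  next
    case False
    then have i: "1 \<le> i" by simp
    consider "n = 0" | "n = 1" | m where "n = Suc m" "1 \<le> m" by (cases n; cases "n - 1") auto
    then show ?thesis
    proof cases
      case 1
      have "{x. dst x u = 0 \<and> dst x z = i} = (if i = t then {u} else {})"
        by (auto simp: t_def)
      then show ?thesis using 1 Q by (simp add: joint_count_def F_def abel_coeff_def)
    next
      case 2
      have "joint_count u z n i = real (card {y. dst y u = 1 \<and> dst y z = i})"
        by (simp add: joint_count_def 2)
      also have "\<dots> = of_bool (t = Suc i) + (real k - 2) * of_bool (t = i) +
          out_degree i * of_bool (Suc t = i)"
        unfolding t_def by (rule card_neighbours_at_distance[OF i])
      also have "\<dots> = F n i"
      proof -
        \<comment> \<open>In the first three cases the exponent of \<open>Q\<close> is 0, 1/2 and 1,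
          which yields the one inward, the \<open>k - 2\<close> sideways and the \<open>Q\<close>
          outward steps.\<close>
        consider "t = Suc i" | "t = i" | "Suc t = i" | "t \<noteq> Suc i" "t \<noteq> i" "Suc t \<noteq> i" by blast
        then show ?thesis
        proof cases
          case b: 2
          then show ?thesis using 2 Q by (simp add: F_def abel_coeff_def powr_half_sqrt)
        next
          case 4
          then have "\<bar>int t - int i\<bar> > 1" by linarith
          then show ?thesis using 4 2 by (simp add: F_def abel_coeff_eq_0)
        qed (use 2 nt Q in \<open>auto simp: F_def abel_coeff_def out_degree_def\<close>)
      qed
      finally show ?thesis .
    next
      case 3
      have "joint_count u z (Suc m) i + out_degree m * joint_count u z (m - 1) i =
          joint_count u z m (Suc i) + out_degree i * joint_count u z m (i - 1)"
        by (rule joint_count_recurrence[OF 3(2) i])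
      \<comment> \<open>The exceptional degree at \<open>i = 1\<close> is multiplied by a boundary
        value 0, so \<open>Q\<close> may replace it.\<close>
      moreover have "out_degree i * joint_count u z m (i - 1) = Q * F m (i - 1)"
        using zero[of m] nt 3 IH[of m "i - 1"] by (cases "i = 1") (auto simp: out_degree_def)
      ultimately have "joint_count u z n i = F m (Suc i) + Q * F m (i - 1) - out_degree m * F (m - 1) i"
        using IH[of m "Suc i"] IH[of "m - 1" i] 3 by simp
      also have "\<dots> = F n i"
      proof -
        \<comment> \<open>The common power of \<open>Q\<close>: the terms at
          \<open>(m, i + 1)\<close> and \<open>(n, i)\<close> carry \<open>Q * p\<close>, those at
          \<open>(m, i - 1)\<close> and \<open>(m - 1, i)\<close> carry \<open>p\<close>.\<close>
        define p where "p = Q powr ((real m - 1 - real t + real i) / 2)"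
        have half: "Q powr (x + 1) = Q * Q powr x" for x
          using Q by (simp add: powr_add)
        have "F m (Suc i) = Q * p * abel_coeff m (int t - int i - 1)"
          using half[of "(real m - 1 - real t + real i) / 2"]
          by (simp add: F_def p_def field_simps)
        moreover have "F m (i - 1) = p * abel_coeff m (int t - int i + 1)"
          using i by (simp add: F_def p_def of_nat_diff algebra_simps)
        moreover have "F (m - 1) i = p * abel_coeff (m - 1) (int t - int i)"
          using 3 by (simp add: F_def p_def of_nat_diff)
        moreover have "F n i = Q * p * abel_coeff (Suc m) (int t - int i)"
          using half[of "(real m - 1 - real t + real i) / 2"]
          by (simp add: F_def p_def 3 field_simps)
        moreover have "out_degree m * c = Q * (out_degree m / Q * c)" for c using Q by simp
        moreover have "abel_coeff (Suc m) (int t - int i) = abel_coeff m (int t - int i - 1) +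
            abel_coeff m (int t - int i + 1) - out_degree m / Q * abel_coeff (m - 1) (int t - int i)"
          using abel_coeff_recurrence[OF 3(2), of "int t - int i"] by simp
        ultimately show ?thesis by (simp only:) (simp only: algebra_simps)
      qed
      finally show ?thesis .
    qed
  qed
  then show ?case by (simp add: F_def t_def)
qed

text \<open>On vertices of length \<open>n\<close> the Busemann function is computed at
  \<open>z\<close>, the point of the ray with index \<open>n + 1\<close>. So the horocycle condition
  says that the distance to \<open>z\<close> is \<open>n + 1 - h\<close>, and \<open>n\<close> is
  just below the distance of the two centres.\<close>

lemma card_horocycle_sphere:
  assumes "\<omega> \<in> boundary E k u"
  shows "real (card {x \<in> horocycle E k u \<omega> h. dst x u = n}) =
    Q powr ((real n - of_int h) / 2) * abel_coeff n h"
proof -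
  define z where "z = \<omega> (Suc n)"
  have "int (dst (\<omega> 0) (\<omega> (Suc n))) = \<bar>int 0 - int (Suc n)\<bar>" and "\<omega> 0 = u"
    using assms unfolding boundary_def by blast+
  then have uz: "dst u z = Suc n" by (simp add: z_def)
  have mem: "x \<in> horocycle E k u \<omega> h \<and> dst x u = n \<longleftrightarrow>
      dst x u = n \<and> int (dst x z) = int (Suc n) - h" for x
    using uz by (auto simp: horocycle_def busemann_def poly_length_def Let_def z_def)
  show ?thesis
  proof (cases "h \<le> int (Suc n)")
    case True
    define i where "i = nat (int (Suc n) - h)"
    have i: "int i = int (Suc n) - h" using True by (simp add: i_def)
    then have "{x \<in> horocycle E k u \<omega> h. dst x u = n} = {x. dst x u = n \<and> dst x z = i}"
      unfolding mem by auto
    then have "real (card {x \<in> horocycle E k u \<omega> h. dst x u = n}) = joint_count u z n i"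
      by (simp add: joint_count_def)
    also have "\<dots> = Q powr ((real n - real (dst u z) + real i) / 2) * abel_coeff n (int (dst u z) - int i)"
      by (rule joint_count_eq) (simp add: uz)
    also have "int (dst u z) - int i = h" by (simp add: uz i)
    also have "real n - real (dst u z) + real i = real n - of_int h"
      using arg_cong[OF i, of real_of_int] by (simp add: uz)
    finally show ?thesis .
  next
    case False
    then have "{x \<in> horocycle E k u \<omega> h. dst x u = n} = {}" unfolding mem by auto
    moreover have "abel_coeff n h = 0" using False by (intro abel_coeff_eq_0) linarith
    ultimately show ?thesis by (simp only: card.empty of_nat_0 mult_zero_right)
  qed
qed

end

text \<open>The chosen vertex depends on \<open>L\<close> and \<open>n\<close> alone and the default
  is 0, so the value is linear in \<open>f\<close> for all functions \<open>f\<close>.\<close>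

definition radial_value :: "('v \<Rightarrow> nat) \<Rightarrow> ('v \<Rightarrow> complex) \<Rightarrow> nat \<Rightarrow> complex" where
  "radial_value L f n = (if \<exists>x. L x = n then f (SOME x. L x = n) else 0)"

lemma radial_value_eq:
  assumes "radial L f"
  shows "radial_value L f (L x) = f x"
proof -
  have "L (SOME y. L y = L x) = L x" by (rule someI[of "\<lambda>y. L y = L x" x]) simp
  then have "f (SOME y. L y = L x) = f x" using assms unfolding radial_def by blast
  moreover have "radial_value L f (L x) = f (SOME y. L y = L x)"
    unfolding radial_value_def by (rule if_P) (rule exI, rule refl)
  ultimately show ?thesis by simp
qed

lemma radial_value_nonzeroE:
  assumes "radial_value L f n \<noteq> 0"
  obtains x where "L x = n" "f x = radial_value L f n"
proof -
  have ex: "\<exists>x. L x = n" using assms unfolding radial_value_def by presburger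
  have "L (SOME x. L x = n) = n" by (rule someI_ex[OF ex])
  moreover have "f (SOME x. L x = n) = radial_value L f n"
    unfolding radial_value_def by (rule if_P[OF ex, symmetric])
  ultimately show thesis by (rule that)
qed

section \<open>The series that extends the Abel transform\<close>

context polygonal_graph
begin

text \<open>The sum over a horocycle is arranged by length, and the factor
  \<open>Q powr (h / 2)\<close> is absorbed into the size of each piece. No ray has to be chosen,
  and evenness in \<open>h\<close> is inherited from the coefficients.\<close>

definition abel_extension :: "'v \<Rightarrow> ('v \<Rightarrow> complex) \<Rightarrow> int \<Rightarrow> complex" where
  "abel_extension u f h = (\<Sum>\<^sub>\<infinity>n. of_real (Q powr (real n / 2) * abel_coeff n h) *
     radial_value (poly_length E k u) f n)"

lemma abel_extension_eq_abel:
  assumes f: "radial (poly_length E k u) f" "finite {x. f x \<noteq> 0}" and \<omega>: "\<omega> \<in> boundary E k u"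
  shows "abel_extension u f = abel E k u Q \<omega> f"
proof
  fix h
  define L where "L = poly_length E k u"
  define F where "F = radial_value L f"
  define H where "H = horocycle E k u \<omega> h"
  have L: "L x = dst x u" for x by (simp add: L_def poly_length_def)
  have F: "F (L x) = f x" for x
    unfolding F_def L_def by (rule radial_value_eq[OF f(1)])
  have Q: "Q > 0" using Q_ge_1 by linarith
  obtain M where M: "\<And>x. f x \<noteq> 0 \<Longrightarrow> L x \<le> M"
    using finite_nat_set_iff_bounded_le[of "L ` {x. f x \<noteq> 0}"] f(2) by auto
  have F0: "F n = 0" if "n > M" for n
  proof (rule ccontr)
    assume "F n \<noteq> 0"
    then obtain x where "L x = n" "f x = F n" unfolding F_def by (rule radial_value_nonzeroE)
    then show False using M[of x] \<open>F n \<noteq> 0\<close> that by simp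
  qed
  \<comment> \<open>The horocycle is truncated by length instead of by the support of
    \<open>f\<close>, so that \<open>B\<close> is a union of full intersections with spheres, whose
    sizes are known.\<close>
  define B where "B = {x \<in> H. L x \<le> M}"
  have "B \<subseteq> (\<Union>n\<in>{..M}. {x. dst x u = n})" by (auto simp: B_def L)
  moreover have "finite (\<Union>n\<in>{..M}. {x. dst x u = n})"
    by (intro finite_UN_I finite_sphere finite_atMost)
  ultimately have finB: "finite B" by (rule finite_subset)
  have "(\<Sum>\<^sub>\<infinity>x\<in>H. f x) = (\<Sum>\<^sub>\<infinity>x\<in>B. f x)"
    by (rule infsum_cong_neutral) (use M in \<open>auto simp: B_def\<close>)
  also have "\<dots> = (\<Sum>x\<in>B. f x)" using finB by simp
  also have "\<dots> = (\<Sum>n\<le>M. \<Sum>x | x \<in> B \<and> L x = n. f x)"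
    by (rule sum.group[symmetric]) (use finB in \<open>auto simp: B_def\<close>)
  also have "\<dots> = (\<Sum>n\<le>M. of_real (Q powr ((real n - of_int h) / 2) * abel_coeff n h) * F n)"
  proof (rule sum.cong[OF refl])
    fix n assume n: "n \<in> {..M}"
    have "{x. x \<in> B \<and> L x = n} = {x \<in> H. dst x u = n}" using n by (auto simp: B_def L)
    then have card: "real (card {x. x \<in> B \<and> L x = n}) = Q powr ((real n - of_int h) / 2) * abel_coeff n h"
      unfolding H_def using card_horocycle_sphere[OF \<omega>, of h n] by simp
    have "(\<Sum>x | x \<in> B \<and> L x = n. f x) = (\<Sum>x | x \<in> B \<and> L x = n. F n)"
      by (rule sum.cong) (auto simp: F[symmetric])
    also have "\<dots> = of_real (real (card {x. x \<in> B \<and> L x = n})) * F n" by simp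
    finally show "(\<Sum>x | x \<in> B \<and> L x = n. f x) =
        of_real (Q powr ((real n - of_int h) / 2) * abel_coeff n h) * F n"
      unfolding card .
  qed
  finally have "abel E k u Q \<omega> f h =
      (\<Sum>n\<le>M. of_real (Q powr (of_int h / 2) * (Q powr ((real n - of_int h) / 2) * abel_coeff n h)) * F n)"
    by (simp add: abel_def H_def[symmetric] sum_distrib_left mult.assoc)
  also have "\<dots> = (\<Sum>n\<le>M. of_real (Q powr (real n / 2) * abel_coeff n h) * F n)"
    by (intro sum.cong refl) (simp add: mult.assoc[symmetric] powr_add[symmetric] diff_divide_distrib Q
      flip: of_real_mult)
  also have "\<dots> = (\<Sum>\<^sub>\<infinity>n\<in>{..M}. of_real (Q powr (real n / 2) * abel_coeff n h) * F n)"
    by simp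
  also have "\<dots> = (\<Sum>\<^sub>\<infinity>n. of_real (Q powr (real n / 2) * abel_coeff n h) * F n)"
    by (rule infsum_cong_neutral) (use F0 in auto)
  finally show "abel_extension u f h = abel E k u Q \<omega> f h"
    by (simp add: abel_extension_def F_def L_def)
qed

end

section \<open>Weighted supremum norms\<close>

text \<open>Only preimages of subbasic sets need to be open, so it is enough to bound each single
  norm of the image by a multiple of one norm.\<close>

lemma continuous_map_norms_topology:
  fixes S :: "('a \<Rightarrow> complex) set" and S' :: "('b \<Rightarrow> complex) set"
  assumes diff: "\<And>f g. f \<in> S \<Longrightarrow> g \<in> S \<Longrightarrow> (\<lambda>x. f x - g x) \<in> S"
    and N_zero: "\<And>m. N m (\<lambda>x. 0) = 0" and N'_zero: "\<And>m. N' m (\<lambda>x. 0) = 0"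
    and triangle: "\<And>m f g h. f \<in> S' \<Longrightarrow> g \<in> S' \<Longrightarrow> h \<in> S' \<Longrightarrow>
      N' m (\<lambda>x. f x - h x) \<le> N' m (\<lambda>x. f x - g x) + N' m (\<lambda>x. g x - h x)"
    and T_in: "\<And>f. f \<in> S \<Longrightarrow> T f \<in> S'"
    and T_diff: "\<And>f g. f \<in> S \<Longrightarrow> g \<in> S \<Longrightarrow> T (\<lambda>x. f x - g x) = (\<lambda>y. T f y - T g y)"
    and bound: "\<And>m. \<exists>m' C. 0 \<le> C \<and> (\<forall>f\<in>S. N' m (T f) \<le> C * N m' f)"
  shows "continuous_map (norms_topology S N) (norms_topology S' N') T"
proof -
  have top: "topspace (norms_topology S N) = S" "topspace (norms_topology S' N') = S'"
    by (rule topspace_norms_topology, fact)+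
  show ?thesis
    unfolding norms_topology_def[of S']
  proof (rule continuous_on_generated_topo)
    fix U assume "U \<in> {{g \<in> S'. N' m (\<lambda>x. g x - f x) < e} | f m e. f \<in> S' \<and> 0 < e}"
    then obtain f m e where U: "U = {g \<in> S'. N' m (\<lambda>x. g x - f x) < e}" and f: "f \<in> S'" by blast
    obtain m' C where C: "0 \<le> C" "\<And>f. f \<in> S \<Longrightarrow> N' m (T f) \<le> C * N m' f"
      using bound[of m] by blast
    show "openin (norms_topology S N) (T -` U \<inter> topspace (norms_topology S N))"
    proof (subst openin_subopen, intro ballI)
      fix g assume "g \<in> T -` U \<inter> topspace (norms_topology S N)"
      then have g: "g \<in> S" "N' m (\<lambda>x. T g x - f x) < e" by (auto simp: top U)
      \<comment> \<open>The denominator \<open>C + 1\<close> is positive even if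
        \<open>C = 0\<close>, and its excess over \<open>C\<close> yields a strict
        inequality.\<close>
      define \<delta> where "\<delta> = (e - N' m (\<lambda>x. T g x - f x)) / (C + 1)"
      have \<delta>: "0 < \<delta>" using g C by (simp add: \<delta>_def)
      define V where "V = {h \<in> S. N m' (\<lambda>x. h x - g x) < \<delta>}"
      have "openin (norms_topology S N) V"
        unfolding norms_topology_def V_def by (rule topology_generated_by_Basis) (use g \<delta> in blast)
      moreover have "g \<in> V" using g \<delta> N_zero by (simp add: V_def)
      moreover have "T h \<in> U" if "h \<in> V" for h
      proof -
        have h: "h \<in> S" "N m' (\<lambda>x. h x - g x) < \<delta>" using that by (auto simp: V_def)
        have "N' m (\<lambda>x. T h x - T g x) \<le> C * N m' (\<lambda>x. h x - g x)"
          using C(2)[OF diff[OF h(1) g(1)]] T_diff[OF h(1) g(1)] by simp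
        also have "\<dots> \<le> C * \<delta>" using C(1) h(2) by (simp add: mult_left_mono)
        also have "\<dots> < (C + 1) * \<delta>" using \<delta> by (simp add: algebra_simps)
        also have "\<dots> = e - N' m (\<lambda>x. T g x - f x)" using C(1) by (simp add: \<delta>_def)
        finally show ?thesis
          using triangle[OF T_in[OF h(1)] T_in[OF g(1)] f, of m] T_in[OF h(1)] by (simp add: U)
      qed
      ultimately show "\<exists>V. openin (norms_topology S N) V \<and> g \<in> V \<and>
          V \<subseteq> T -` U \<inter> topspace (norms_topology S N)"
        unfolding top by (intro exI[of _ V]) (auto simp: V_def)
    qed
  next
    show "T ` topspace (norms_topology S N) \<subseteq>
        \<Union>{{g \<in> S'. N' m (\<lambda>x. g x - f x) < e} | f m e. f \<in> S' \<and> 0 < e}"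
      using T_in top(2) unfolding top(1) norms_topology_def topology_generated_by_topspace by blast
  qed
qed

text \<open>Both kinds of Schwartz spaces have this form with suitable weights, so one criterion
  serves the transform and its inverse.\<close>

definition weighted_bounded :: "(nat \<Rightarrow> 'a \<Rightarrow> real) \<Rightarrow> ('a \<Rightarrow> complex) \<Rightarrow> bool" where
  "weighted_bounded w f \<longleftrightarrow> (\<forall>m. bdd_above (range (\<lambda>x. w m x * cmod (f x))))"

definition weighted_norm :: "(nat \<Rightarrow> 'a \<Rightarrow> real) \<Rightarrow> nat \<Rightarrow> ('a \<Rightarrow> complex) \<Rightarrow> real" where
  "weighted_norm w m f = (SUP x. w m x * cmod (f x))"

lemma weighted_norm_upper: "weighted_bounded w f \<Longrightarrow> w m x * cmod (f x) \<le> weighted_norm w m f"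
  unfolding weighted_bounded_def weighted_norm_def by (intro cSUP_upper) auto

lemma weighted_norm_nonneg:
  assumes "\<And>m x. 0 \<le> w m x" and "weighted_bounded w f"
  shows "0 \<le> weighted_norm w m f"
  using weighted_norm_upper[OF assms(2), of m undefined] assms(1)[of m undefined]
  by (meson mult_nonneg_nonneg norm_ge_zero order_trans)

lemma weighted_norm_least: "(\<And>x. w m x * cmod (f x) \<le> B) \<Longrightarrow> weighted_norm w m f \<le> B"
  unfolding weighted_norm_def by (rule cSUP_least) auto

lemma weighted_boundedI: "(\<And>m. \<exists>B. \<forall>x. w m x * cmod (f x) \<le> B) \<Longrightarrow> weighted_bounded w f"
  unfolding weighted_bounded_def bdd_above_def by auto

lemma weighted_diff_le:
  assumes w: "\<And>m x. 0 \<le> w m x" and "weighted_bounded w f" "weighted_bounded w g"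
  shows "w m x * cmod (f x - g x) \<le> weighted_norm w m f + weighted_norm w m g"
proof -
  have "w m x * cmod (f x - g x) \<le> w m x * (cmod (f x) + cmod (g x))"
    using w by (intro mult_left_mono norm_triangle_ineq4)
  also have "\<dots> \<le> weighted_norm w m f + weighted_norm w m g"
    unfolding distrib_left using assms(2,3) by (intro add_mono weighted_norm_upper)
  finally show ?thesis .
qed

lemma weighted_bounded_diff:
  assumes "\<And>m x. 0 \<le> w m x" and "weighted_bounded w f" "weighted_bounded w g"
  shows "weighted_bounded w (\<lambda>x. f x - g x)"
  using weighted_diff_le[OF assms] by (intro weighted_boundedI) blast

text \<open>The pointwise estimate \<open>bound\<close> is used twice: it shows that the image lies
  in the target space, and that the map is continuous.\<close>

lemma continuous_linear_map_weighted:
  fixes w :: "nat \<Rightarrow> 'a \<Rightarrow> real" and w' :: "nat \<Rightarrow> 'b \<Rightarrow> real"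
  assumes S: "S = {f. R f \<and> weighted_bounded w f}" and S': "S' = {f. R' f \<and> weighted_bounded w' f}"
    and w: "\<And>m x. 0 \<le> w m x" "\<And>m x. 0 \<le> w' m x"
    and R_diff: "\<And>f g. R f \<Longrightarrow> R g \<Longrightarrow> R (\<lambda>x. f x - g x)"
    and R'_diff: "\<And>f g. R' f \<Longrightarrow> R' g \<Longrightarrow> R' (\<lambda>x. f x - g x)"
    and T_R': "\<And>f. f \<in> S \<Longrightarrow> R' (T f)"
    and T_add: "\<And>f g. f \<in> S \<Longrightarrow> g \<in> S \<Longrightarrow> T (\<lambda>x. f x + g x) = (\<lambda>y. T f y + T g y)"
    and T_scale: "\<And>c f. f \<in> S \<Longrightarrow> T (\<lambda>x. c * f x) = (\<lambda>y. c * T f y)"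
    and bound: "\<And>m. \<exists>m' C. 0 \<le> C \<and> (\<forall>f\<in>S. \<forall>y. w' m y * cmod (T f y) \<le> C * weighted_norm w m' f)"
  shows "continuous_linear_map (norms_topology S (weighted_norm w)) (norms_topology S' (weighted_norm w')) T"
proof -
  have zero: "weighted_norm v m (\<lambda>x. 0) = 0" for v :: "nat \<Rightarrow> 'c \<Rightarrow> real" and m
    by (simp add: weighted_norm_def)
  have diff: "(\<lambda>x. f x - g x) \<in> S" if "f \<in> S" "g \<in> S" for f g
    using that R_diff weighted_bounded_diff[of w f g, OF w(1)] by (simp add: S)
  have T_in: "T f \<in> S'" if "f \<in> S" for f
  proof -
    have "weighted_bounded w' (T f)" using bound that by (intro weighted_boundedI) blast
    then show ?thesis using T_R'[OF that] by (simp add: S')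
  qed
  have "continuous_map (norms_topology S (weighted_norm w)) (norms_topology S' (weighted_norm w')) T"
  proof (rule continuous_map_norms_topology[where S = S and S' = S'])
    fix m f g h assume *: "f \<in> S'" "g \<in> S'" "h \<in> S'"
    have "weighted_bounded w' (\<lambda>x. f x - g x)" "weighted_bounded w' (\<lambda>x. g x - h x)"
      using * by (auto simp: S' intro!: weighted_bounded_diff w)
    moreover have "w' m x * cmod (f x - h x) \<le> w' m x * cmod (f x - g x) + w' m x * cmod (g x - h x)" for x
      using mult_left_mono[OF norm_triangle_ineq[of "f x - g x" "g x - h x"] w(2)[of m x]]
      by (simp add: distrib_left)
    ultimately show "weighted_norm w' m (\<lambda>x. f x - h x) \<le>
        weighted_norm w' m (\<lambda>x. f x - g x) + weighted_norm w' m (\<lambda>x. g x - h x)"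
      by (intro weighted_norm_least) (meson add_mono order_trans weighted_norm_upper)
  next
    fix f g assume *: "f \<in> S" "g \<in> S"
    have "T (\<lambda>x. (f x - g x) + g x) = (\<lambda>y. T (\<lambda>x. f x - g x) y + T g y)"
      using T_add[OF diff[OF *] *(2)] .
    then show "T (\<lambda>x. f x - g x) = (\<lambda>y. T f y - T g y)" by simp
  next
    fix m
    show "\<exists>m' C. 0 \<le> C \<and> (\<forall>f\<in>S. weighted_norm w' m (T f) \<le> C * weighted_norm w m' f)"
      using bound[of m] weighted_norm_least[of w' m] by meson
  qed (simp_all add: diff zero T_in)
  then show ?thesis
    unfolding continuous_linear_map_def topspace_norms_topology[of "weighted_norm w", OF zero]
    using T_add T_scale by simp
qed

section \<open>The two kinds of Schwartz spaces as weighted spaces\<close>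

definition schwartz_weight :: "real \<Rightarrow> real \<Rightarrow> ('a \<Rightarrow> real) \<Rightarrow> nat \<Rightarrow> 'a \<Rightarrow> real" where
  "schwartz_weight Q a l m x = (1 + l x) ^ m * Q powr (a * l x)"

lemma schwartz_weight_nonneg: "(\<And>x. 0 \<le> l x) \<Longrightarrow> 0 \<le> schwartz_weight Q a l m x"
  by (simp add: schwartz_weight_def)

lemma schwartz_radial_eq:
  "schwartz_radial Q L p =
    {f. radial L f \<and> weighted_bounded (schwartz_weight Q (1 / p) (\<lambda>x. real (L x))) f}"
  and schwartz_radial_topology_eq:
  "schwartz_radial_topology Q L p =
    norms_topology (schwartz_radial Q L p) (weighted_norm (schwartz_weight Q (1 / p) (\<lambda>x. real (L x))))"
proof -
  have eq: "schwartz_weighted Q L p m f x =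
      schwartz_weight Q (1 / p) (\<lambda>x. real (L x)) m x * cmod (f x)" for m f x
    by (simp add: schwartz_weighted_def schwartz_weight_def)
  show "schwartz_radial Q L p =
    {f. radial L f \<and> weighted_bounded (schwartz_weight Q (1 / p) (\<lambda>x. real (L x))) f}"
    unfolding schwartz_radial_def weighted_bounded_def eq by simp
  have "schwartz_norm Q L p = weighted_norm (schwartz_weight Q (1 / p) (\<lambda>x. real (L x)))"
    by (intro ext) (simp add: schwartz_norm_def weighted_norm_def eq)
  then show "schwartz_radial_topology Q L p =
    norms_topology (schwartz_radial Q L p) (weighted_norm (schwartz_weight Q (1 / p) (\<lambda>x. real (L x))))"
    by (simp add: schwartz_radial_topology_def)
qed

lemma weighted_schwartz_even_eq:
  "weighted_schwartz_even Q a =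
    {g. (\<forall>n. g (- n) = g n) \<and> weighted_bounded (schwartz_weight Q a (\<lambda>n. \<bar>real_of_int n\<bar>)) g}"
  and weighted_schwartz_even_topology_eq:
  "weighted_schwartz_even_topology Q a =
    norms_topology (weighted_schwartz_even Q a) (weighted_norm (schwartz_weight Q a (\<lambda>n. \<bar>real_of_int n\<bar>)))"
proof -
  have eq: "(1 + real_of_int \<bar>n\<bar>) ^ m * cmod (expweight Q a g n) =
      schwartz_weight Q a (\<lambda>n. \<bar>real_of_int n\<bar>) m n * cmod (g n)" for m g n
    by (simp add: expweight_def schwartz_weight_def norm_mult)
  show "weighted_schwartz_even Q a =
    {g. (\<forall>n. g (- n) = g n) \<and> weighted_bounded (schwartz_weight Q a (\<lambda>n. \<bar>real_of_int n\<bar>)) g}"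
    unfolding weighted_schwartz_even_def schwartz_int_even_def weighted_bounded_def mem_Collect_eq eq
    by (auto simp: expweight_def)
  have "(\<lambda>m g. schwartz_int_norm m (expweight Q a g)) =
      weighted_norm (schwartz_weight Q a (\<lambda>n. \<bar>real_of_int n\<bar>))"
    by (intro ext) (simp add: schwartz_int_norm_def weighted_norm_def eq del: of_int_abs)
  then show "weighted_schwartz_even_topology Q a =
    norms_topology (weighted_schwartz_even Q a) (weighted_norm (schwartz_weight Q a (\<lambda>n. \<bar>real_of_int n\<bar>)))"
    by (simp add: weighted_schwartz_even_topology_def)
qed

lemma radial_diff: "radial L f \<Longrightarrow> radial L g \<Longrightarrow> radial L (\<lambda>x. f x - g x)"
  unfolding radial_def by metis

text \<open>Applied with all natural numbers for the transform and with \<open>{1..}\<close> for its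
  inverse. The square is paid for by passing from a norm of order \<open>m\<close> to one of order
  \<open>m + 2\<close>.\<close>

lemma infsum_inverse_square_bound:
  fixes t :: "nat \<Rightarrow> complex"
  assumes t: "\<And>n. n \<in> A \<Longrightarrow> cmod (t n) \<le> D / (1 + real n) ^ 2" and D: "0 \<le> D"
  shows "t summable_on A"
    and "cmod (infsum t A) \<le> D * (\<Sum>\<^sub>\<infinity>n. 1 / (1 + real n) ^ 2)"
proof -
  have "summable (\<lambda>n. 1 / (1 + real n) ^ 2)"
    using summable_Suc_iff[of "\<lambda>n. inverse (real n ^ 2)"] inverse_power_summable[of 2, where 'a = real]
    by (simp add: field_simps)
  then have sq: "(\<lambda>n. 1 / (1 + real n) ^ 2) summable_on UNIV"
    by (intro summable_nonneg_imp_summable_on) auto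
  then have D_sq: "(\<lambda>n. D * (1 / (1 + real n) ^ 2)) summable_on UNIV"
    by (rule summable_on_cmult_right)
  then have D_sq_A: "(\<lambda>n. D * (1 / (1 + real n) ^ 2)) summable_on A"
    by (rule summable_on_subset_banach) simp
  have abs: "(\<lambda>n. norm (t n)) summable_on A"
    by (rule summable_on_comparison_test[OF D_sq_A]) (use t in auto)
  then show "t summable_on A" by (rule abs_summable_summable)
  have "cmod (infsum t A) \<le> (\<Sum>\<^sub>\<infinity>n\<in>A. norm (t n))" by (rule norm_infsum_bound[OF abs])
  also have "\<dots> \<le> (\<Sum>\<^sub>\<infinity>n\<in>A. D * (1 / (1 + real n) ^ 2))"
    by (rule infsum_mono[OF abs D_sq_A]) (use t in simp)
  also have "\<dots> \<le> (\<Sum>\<^sub>\<infinity>n. D * (1 / (1 + real n) ^ 2))"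
    by (rule infsum_mono_neutral[OF D_sq_A D_sq]) (use D in auto)
  also have "\<dots> = D * (\<Sum>\<^sub>\<infinity>n. 1 / (1 + real n) ^ 2)" by (rule infsum_cmult_right')
  finally show "cmod (infsum t A) \<le> D * (\<Sum>\<^sub>\<infinity>n. 1 / (1 + real n) ^ 2)" .
qed

section \<open>Estimates for the Abel transform and its inverse\<close>

text \<open>Only terms with \<open>|h| \<le> n\<close> survive, and \<open>1 / p - 1 / 2\<close> is
  nonnegative, so the weight at \<open>h\<close> is at most the weight at \<open>n\<close>. The
  factor \<open>Q powr (n / 2)\<close> then completes \<open>Q powr ((1 / p - 1 / 2) * n)\<close> to
  the weight \<open>Q powr (n / p)\<close> of the group.\<close>

lemma abel_series_bound:
  fixes c :: "nat \<Rightarrow> int \<Rightarrow> real"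
  assumes Q: "1 \<le> Q" and p: "0 < p" "p \<le> 2"
    and c: "\<bar>c n h\<bar> \<le> B" "int n < \<bar>h\<bar> \<Longrightarrow> c n h = 0"
    and f: "f \<in> schwartz_radial Q L p"
  shows "cmod (of_real (Q powr (real n / 2) * c n h) * radial_value L f n) \<le>
    (B * weighted_norm (schwartz_weight Q (1 / p) (\<lambda>x. real (L x))) (m + 2) f /
      schwartz_weight Q (1 / p - 1 / 2) (\<lambda>n. \<bar>real_of_int n\<bar>) m h) / (1 + real n) ^ 2"
    (is "?t \<le> (B * ?W / ?v) / _")
proof (cases "c n h = 0 \<or> radial_value L f n = 0")
  case True
  have "0 \<le> ?W"
    using f by (intro weighted_norm_nonneg schwartz_weight_nonneg) (simp_all add: schwartz_radial_eq)
  moreover have "0 \<le> B" using c(1) by linarith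
  moreover have "0 \<le> ?v" by (simp add: schwartz_weight_nonneg)
  ultimately show ?thesis using True by auto
next
  case False
  define v where "v = radial_value L f n"
  have B: "0 \<le> B" using c(1) by linarith
  have n: "\<bar>real_of_int h\<bar> \<le> real n"
  proof -
    have "\<bar>h\<bar> \<le> int n" using False c(2) by force
    then show ?thesis by linarith
  qed
  obtain x where x: "L x = n" "f x = v" using False unfolding v_def by (auto elim: radial_value_nonzeroE)
  have W: "(1 + real n) ^ (m + 2) * Q powr (real n / p) * cmod v \<le> ?W"
    using weighted_norm_upper[of "schwartz_weight Q (1 / p) (\<lambda>x. real (L x))" f "m + 2" x] f x
    by (simp add: schwartz_radial_eq schwartz_weight_def)
  have v_pos: "0 < ?v" using Q by (simp add: schwartz_weight_def)
  have "?v \<le> (1 + real n) ^ m * Q powr ((1 / p - 1 / 2) * real n)"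
    unfolding schwartz_weight_def
    using n Q p by (intro mult_mono power_mono powr_mono mult_left_mono) (auto simp: field_simps)
  then have "?v * (1 + real n) ^ 2 * ?t \<le>
      ((1 + real n) ^ m * Q powr ((1 / p - 1 / 2) * real n)) * (1 + real n) ^ 2 *
        (Q powr (real n / 2) * B * cmod v)"
    using c(1) B v_pos by (intro mult_mono) (auto simp: norm_mult v_def abs_mult intro!: mult_right_mono mult_left_mono)
  also have "\<dots> = B * ((1 + real n) ^ (m + 2) * (Q powr ((1 / p - 1 / 2) * real n) * Q powr (real n / 2)) * cmod v)"
    by (simp add: power_add power2_eq_square)
  also have "Q powr ((1 / p - 1 / 2) * real n) * Q powr (real n / 2) = Q powr (real n / p)"
    by (simp add: powr_add[symmetric] algebra_simps)
  also have "B * ((1 + real n) ^ (m + 2) * Q powr (real n / p) * cmod v) \<le> B * ?W"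
    using W B by (rule mult_left_mono)
  finally show ?thesis using v_pos by (simp add: field_simps)
qed

text \<open>The constant 16 is the product of 2 from the coefficient, 2 from the two values of
  \<open>g\<close>, and 4 from separating \<open>n\<close> and \<open>m\<close> in the polynomial
  weight.\<close>

lemma abel_inv_term_bound:
  assumes Q: "1 \<le> Q" and p: "0 < p" "p \<le> 2" and k: "1 \<le> k" "real k - 1 \<le> Q powr (1 / p)"
    and g: "g \<in> weighted_schwartz_even Q (1 / p - 1 / 2)" and m: "1 \<le> m"
  shows "cmod (abel_inv_term k Q g n m) \<le>
    (16 * weighted_norm (schwartz_weight Q (1 / p - 1 / 2) (\<lambda>n. \<bar>real_of_int n\<bar>)) (j + 2) g *
      Q powr (1 / p - 1 / 2) * Q powr (- (1 / p - 1 / 2) * real n) / (1 + real n) ^ j) / (1 + real m) ^ 2"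
    (is "_ \<le> (16 * ?W * _ * _ / _) / _")
proof -
  define a where "a = 1 / p - 1 / 2"
  have a: "0 \<le> a" using p by (simp add: a_def field_simps)
  \<comment> \<open>Both arguments of \<open>g\<close> are at least \<open>s - 1\<close>, so the
    factor \<open>1 + |l|\<close> in the weight is at least \<open>s\<close>.\<close>
  define s where "s = real (n + m)"
  have s: "1 \<le> s" "real n \<le> s - 1" "real m \<le> s" using m by (simp_all add: s_def)
  have W: "(1 + \<bar>real_of_int l\<bar>) ^ (j + 2) * Q powr (a * \<bar>real_of_int l\<bar>) * cmod (g l) \<le> ?W" for l
    using weighted_norm_upper[of "schwartz_weight Q a (\<lambda>n. \<bar>real_of_int n\<bar>)" g "j + 2" l] g
    by (simp add: weighted_schwartz_even_eq schwartz_weight_def a_def)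
  have W0: "0 \<le> ?W"
    using g by (intro weighted_norm_nonneg schwartz_weight_nonneg) (simp_all add: weighted_schwartz_even_eq)
  have g_le: "cmod (g l) \<le> ?W * Q powr (- a * (s - 1)) / s ^ (j + 2)" if l: "s - 1 \<le> real_of_int l" for l
  proof -
    have "s ^ (j + 2) * Q powr (a * (s - 1)) * cmod (g l) \<le>
        (1 + \<bar>real_of_int l\<bar>) ^ (j + 2) * Q powr (a * \<bar>real_of_int l\<bar>) * cmod (g l)"
      using l s a Q by (intro mult_mono power_mono powr_mono mult_left_mono) auto
    then have "s ^ (j + 2) * Q powr (a * (s - 1)) * cmod (g l) \<le> ?W" using W[of l] by linarith
    moreover have "Q powr (- a * (s - 1)) = inverse (Q powr (a * (s - 1)))"
      by (simp only: powr_minus[symmetric] mult_minus_left)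
    moreover have "0 < s ^ (j + 2)" "0 < Q powr (a * (s - 1))" using s Q by simp_all
    moreover have "c \<le> W * inverse P / A" if "A * P * c \<le> W" "0 < A" "0 < P" for A P c W :: real
      using that by (simp add: field_simps)
    ultimately show ?thesis by metis
  qed
  \<comment> \<open>The part \<open>Q powr (- a * m)\<close> of the decay of \<open>g\<close> is
    spent here: with \<open>Q powr (- m / 2)\<close> it makes \<open>Q powr (- m / p)\<close>, which
    absorbs \<open>(k - 1) ^ m\<close>.\<close>
  have coeff: "\<bar>1 + (- 1) ^ (m - 1) * (real k - 1) ^ m\<bar> * Q powr (- real m / 2) * Q powr (- a * real m) \<le> 2"
  proof -
    have pow: "Q powr (- real m / 2) * Q powr (- a * real m) = inverse ((Q powr (1 / p)) ^ m)"
    proof -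
      have "- real m / 2 + - a * real m = - (1 / p * real m)" by (simp add: a_def field_simps)
      then have "Q powr (- real m / 2) * Q powr (- a * real m) = Q powr (- (1 / p * real m))"
        by (simp only: powr_add[symmetric])
      then show ?thesis using Q by (simp add: powr_minus powr_realpow[symmetric] powr_powr)
    qed
    have one: "1 \<le> (Q powr (1 / p)) ^ m" using Q p by (intro one_le_power) (simp add: ge_one_powr_ge_zero)
    have "\<bar>1 + (- 1) ^ (m - 1) * (real k - 1) ^ m\<bar> \<le> 1 + \<bar>(- 1) ^ (m - 1) * (real k - 1) ^ m\<bar>"
      by linarith
    also have "\<bar>(- 1) ^ (m - 1) * (real k - 1) ^ m\<bar> = (real k - 1) ^ m"
      using k(1) by (simp add: abs_mult power_abs)
    also have "(real k - 1) ^ m \<le> (Q powr (1 / p)) ^ m" using k by (intro power_mono) auto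
    finally have "\<bar>1 + (- 1) ^ (m - 1) * (real k - 1) ^ m\<bar> \<le> 2 * (Q powr (1 / p)) ^ m" using one by linarith
    then show ?thesis using one unfolding mult.assoc pow by (simp add: field_simps)
  qed
  have diff: "cmod (g (int n + int m - 1) - g (int n + int m + 1)) \<le> 2 * (?W * Q powr (- a * (s - 1)) / s ^ (j + 2))"
    using norm_triangle_ineq4[of "g (int n + int m - 1)" "g (int n + int m + 1)"]
      g_le[of "int n + int m - 1"] g_le[of "int n + int m + 1"] by (simp add: s_def)
  have split: "Q powr (- a * (s - 1)) = Q powr (- a * real m) * (Q powr a * Q powr (- a * real n))"
    by (simp add: powr_add[symmetric] s_def algebra_simps)
  have "cmod (abel_inv_term k Q g n m) =
      \<bar>1 + (- 1) ^ (m - 1) * (real k - 1) ^ m\<bar> * Q powr (- real m / 2) *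
        cmod (g (int n + int m - 1) - g (int n + int m + 1))"
    unfolding abel_inv_term_def norm_mult norm_of_real by (simp add: abs_mult)
  also have "\<dots> \<le> \<bar>1 + (- 1) ^ (m - 1) * (real k - 1) ^ m\<bar> * Q powr (- real m / 2) *
      (2 * (?W * Q powr (- a * (s - 1)) / s ^ (j + 2)))"
    using diff by (intro mult_left_mono) auto
  also have "\<dots> = (\<bar>1 + (- 1) ^ (m - 1) * (real k - 1) ^ m\<bar> * Q powr (- real m / 2) * Q powr (- a * real m)) *
      (2 * ?W * (Q powr a * Q powr (- a * real n)) / s ^ (j + 2))"
    unfolding split by (simp only: mult_ac times_divide_eq_left times_divide_eq_right)
  also have "\<dots> \<le> 2 * (2 * ?W * (Q powr a * Q powr (- a * real n)) / s ^ (j + 2))"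
    using coeff W0 s by (intro mult_right_mono) auto
  also have "\<dots> = 4 * ?W * (Q powr a * Q powr (- a * real n)) * (1 / s ^ (j + 2))" by simp
  \<comment> \<open>Uses \<open>1 + n \<le> s\<close> and \<open>1 + m \<le> 2 * s\<close>, both due
    to \<open>1 \<le> m\<close>.\<close>
  also have "1 / s ^ (j + 2) \<le> 4 / ((1 + real n) ^ j * (1 + real m) ^ 2)"
  proof -
    have "(1 + real n) ^ j * (1 + real m) ^ 2 \<le> s ^ j * (2 * s) ^ 2"
      using s by (intro mult_mono power_mono) auto
    then have "(1 + real n) ^ j * (1 + real m) ^ 2 \<le> 4 * s ^ (j + 2)"
      by (simp add: power_mult_distrib power_add power2_eq_square mult_ac)
    then show ?thesis using s by (simp add: field_simps)
  qed
  then have "4 * ?W * (Q powr a * Q powr (- a * real n)) * (1 / s ^ (j + 2)) \<le>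
      4 * ?W * (Q powr a * Q powr (- a * real n)) * (4 / ((1 + real n) ^ j * (1 + real m) ^ 2))"
    using W0 by (intro mult_left_mono) auto
  finally show ?thesis by (simp add: a_def[symmetric])
qed

lemma
  assumes Q: "1 \<le> Q" and p: "0 < p" "p \<le> 2" and k: "1 \<le> k" "real k - 1 \<le> Q powr (1 / p)"
  shows abel_inv_term_summable:
      "g \<in> weighted_schwartz_even Q (1 / p - 1 / 2) \<Longrightarrow> abel_inv_term k Q g n summable_on {1..}"
    and continuous_linear_map_abel_inv:
      "continuous_linear_map (weighted_schwartz_even_topology Q (1 / p - 1 / 2))
        (schwartz_radial_topology Q L p) (\<lambda>g x. abel_inv k Q g (L x))"
proof -
  define a where "a = 1 / p - 1 / 2"
  define w where "w = schwartz_weight Q a (\<lambda>n. \<bar>real_of_int n\<bar>)"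
  define K :: real where "K = (\<Sum>\<^sub>\<infinity>n::nat. 1 / (1 + real n) ^ 2)"
  \<comment> \<open>Always used at \<open>j + 2\<close>: the index is the order of the norm of
    \<open>g\<close>, and the decay left over in \<open>n\<close> is two orders lower.\<close>
  define D where "D g n j = 16 * weighted_norm w j g * Q powr a * Q powr (- a * real n) / (1 + real n) ^ (j - 2)"
    for g n j
  have W0: "0 \<le> weighted_norm w j g" if "g \<in> weighted_schwartz_even Q a" for g j
    using that unfolding w_def
    by (intro weighted_norm_nonneg schwartz_weight_nonneg) (simp_all add: weighted_schwartz_even_eq)
  have D0: "0 \<le> D g n j" if "g \<in> weighted_schwartz_even Q a" for g n j
    using W0[OF that, of j] by (simp add: D_def)
  have term_le: "cmod (abel_inv_term k Q g n m) \<le> D g n (j + 2) / (1 + real m) ^ 2"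
    if "g \<in> weighted_schwartz_even Q a" "m \<in> {1..}" for g n m j
    using abel_inv_term_bound[OF Q p k, of g m n j] that by (simp add: D_def w_def a_def)
  have summable: "abel_inv_term k Q g n summable_on {1..}" if "g \<in> weighted_schwartz_even Q a" for g n
    using infsum_inverse_square_bound(1)[OF term_le[OF that, of _ n 0] D0[OF that]] .
  then show "g \<in> weighted_schwartz_even Q (1 / p - 1 / 2) \<Longrightarrow> abel_inv_term k Q g n summable_on {1..}"
    by (simp add: a_def)
  show "continuous_linear_map (weighted_schwartz_even_topology Q (1 / p - 1 / 2))
        (schwartz_radial_topology Q L p) (\<lambda>g x. abel_inv k Q g (L x))"
    unfolding weighted_schwartz_even_topology_eq schwartz_radial_topology_eq
  proof (rule continuous_linear_map_weighted[OF weighted_schwartz_even_eq schwartz_radial_eq])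
    fix j
    have "schwartz_weight Q (1 / p) (\<lambda>x. real (L x)) j y * cmod (abel_inv k Q g (L y)) \<le>
        16 * Q powr (a + 1 / 2) * K / real k * weighted_norm w (j + 2) g"
      if g: "g \<in> weighted_schwartz_even Q a" for g y
    proof -
      define n where "n = L y"
      define I where "I = infsum (abel_inv_term k Q g n) {1..}"
      have I: "cmod I \<le> D g n (j + 2) * K"
        unfolding I_def K_def by (rule infsum_inverse_square_bound(2)[OF term_le[OF g] D0[OF g]])
      have "schwartz_weight Q (1 / p) (\<lambda>x. real (L x)) j y * cmod (abel_inv k Q g (L y)) =
          (1 + real n) ^ j * Q powr (real n / p) * (1 / real k * Q powr (- (real n - 1) / 2)) * cmod I"
        unfolding abel_inv_def n_def[symmetric] I_def[symmetric] norm_mult norm_of_real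
        by (simp add: schwartz_weight_def n_def)
      also have "\<dots> \<le> (1 + real n) ^ j * Q powr (real n / p) * (1 / real k * Q powr (- (real n - 1) / 2)) *
          (D g n (j + 2) * K)"
        using I by (intro mult_left_mono) auto
      also have "\<dots> = 16 * weighted_norm w (j + 2) g * K / real k *
          (Q powr (real n / p) * Q powr (- (real n - 1) / 2) * Q powr a * Q powr (- a * real n))"
      proof -
        have "(1 + real n) ^ j \<noteq> 0" by (simp add: add_nonneg_eq_0_iff)
        then show ?thesis by (simp add: D_def)
      qed
      also have "Q powr (real n / p) * Q powr (- (real n - 1) / 2) * Q powr a * Q powr (- a * real n) =
          Q powr (a + 1 / 2)"
      proof -
        \<comment> \<open>All dependence on \<open>n\<close> cancels: the loss
          \<open>1 / p - 1 / 2\<close> in the exponent is exactly the shift between the two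
          weights.\<close>
        have "real n / p + - (real n - 1) / 2 + a + - a * real n = a + 1 / 2"
          by (simp add: a_def field_simps)
        then show ?thesis by (simp only: powr_add[symmetric])
      qed
      finally show ?thesis by (simp add: mult_ac)
    qed
    moreover have "0 \<le> 16 * Q powr (a + 1 / 2) * K / real k"
      unfolding K_def by (intro divide_nonneg_nonneg mult_nonneg_nonneg infsum_nonneg) auto
    ultimately show "\<exists>m' C. 0 \<le> C \<and> (\<forall>f\<in>weighted_schwartz_even Q (1 / p - 1 / 2). \<forall>y.
        schwartz_weight Q (1 / p) (\<lambda>x. real (L x)) j y * cmod (abel_inv k Q f (L y)) \<le>
        C * weighted_norm (schwartz_weight Q (1 / p - 1 / 2) (\<lambda>n. \<bar>real_of_int n\<bar>)) m' f)"
      unfolding a_def[symmetric] w_def[symmetric] by blast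
  next
    fix f g assume fg: "f \<in> weighted_schwartz_even Q (1 / p - 1 / 2)" "g \<in> weighted_schwartz_even Q (1 / p - 1 / 2)"
    have "abel_inv k Q (\<lambda>x. f x + g x) n = abel_inv k Q f n + abel_inv k Q g n" for n
    proof -
      have "abel_inv_term k Q (\<lambda>x. f x + g x) n = (\<lambda>m. abel_inv_term k Q f n m + abel_inv_term k Q g n m)"
        by (auto simp: abel_inv_term_def algebra_simps)
      then show ?thesis
        using infsum_add[OF summable[of f n] summable[of g n]] fg
        by (simp add: abel_inv_def a_def distrib_left)
    qed
    then show "(\<lambda>x. abel_inv k Q (\<lambda>x. f x + g x) (L x)) = (\<lambda>y. abel_inv k Q f (L y) + abel_inv k Q g (L y))"
      by simp
  next
    fix c f
    have "abel_inv k Q (\<lambda>x. c * f x) n = c * abel_inv k Q f n" for n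
    proof -
      have "abel_inv_term k Q (\<lambda>x. c * f x) n = (\<lambda>m. c * abel_inv_term k Q f n m)"
        by (auto simp: abel_inv_term_def algebra_simps)
      then show ?thesis by (simp add: abel_inv_def infsum_cmult_right')
    qed
    then show "(\<lambda>x. abel_inv k Q (\<lambda>x. c * f x) (L x)) = (\<lambda>y. c * abel_inv k Q f (L y))" by simp
  next
    fix f
    show "radial L (\<lambda>x. abel_inv k Q f (L x))" unfolding radial_def by metis
  qed (simp_all add: schwartz_weight_nonneg radial_diff)
qed

section \<open>Continuity of the extended transform, and the theorem\<close>

context polygonal_graph
begin

lemma abel_coeff_bound: "\<bar>abel_coeff n h\<bar> \<le> 1 + (real k - 2) / sqrt Q + (real r - 2) / (real r - 1)"
proof -
  have "0 \<le> (real k - 2) / sqrt Q" "0 \<le> (real r - 2) / (real r - 1)"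
    using k_ge r_ge Q_ge_1 by simp_all
  then show ?thesis unfolding abel_coeff_def by (auto simp del: zero_le_divide_iff)
qed

lemma continuous_linear_map_abel_extension:
  assumes p: "0 < p" "p \<le> 2"
  shows "continuous_linear_map (schwartz_radial_topology Q (poly_length E k u) p)
    (weighted_schwartz_even_topology Q (1 / p - 1 / 2)) (abel_extension u)"
proof -
  define L where "L = poly_length E k u"
  define w where "w = schwartz_weight Q (1 / p) (\<lambda>x. real (L x))"
  define w' where "w' = schwartz_weight Q (1 / p - 1 / 2) (\<lambda>n. \<bar>real_of_int n\<bar>)"
  define K :: real where "K = (\<Sum>\<^sub>\<infinity>n::nat. 1 / (1 + real n) ^ 2)"
  define B where "B = 1 + (real k - 2) / sqrt Q + (real r - 2) / (real r - 1)"
  define t where "t f h n = complex_of_real (Q powr (real n / 2) * abel_coeff n h) * radial_value L f n" for f h n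
  have ext_eq: "abel_extension u f h = (\<Sum>\<^sub>\<infinity>n. t f h n)" for f h
    by (simp add: abel_extension_def t_def L_def)
  have B: "0 \<le> B" using abel_coeff_bound[of 0 0] by (simp add: B_def abel_coeff_def)
  have w'_pos: "0 < w' m h" for m h using Q_ge_1 by (simp add: w'_def schwartz_weight_def)
  have D0: "0 \<le> B * weighted_norm w (m + 2) f / w' m h" if "f \<in> schwartz_radial Q L p" for f m h
  proof -
    have "0 \<le> weighted_norm w (m + 2) f"
      using that unfolding w_def
      by (intro weighted_norm_nonneg schwartz_weight_nonneg) (simp_all add: schwartz_radial_eq)
    then show ?thesis using B w'_pos[of m h] by simp
  qed
  have term_le: "cmod (t f h n) \<le> (B * weighted_norm w (m + 2) f / w' m h) / (1 + real n) ^ 2"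
    if "f \<in> schwartz_radial Q L p" for f h n m
    unfolding t_def w_def w'_def B_def
    by (rule abel_series_bound[where c = abel_coeff, OF Q_ge_1 p abel_coeff_bound _ that])
      (rule abel_coeff_eq_0)
  have summable: "t f h summable_on UNIV" if "f \<in> schwartz_radial Q L p" for f h
    using infsum_inverse_square_bound(1)[OF term_le[OF that, where m = 0] D0[OF that]] .
  show ?thesis
    unfolding weighted_schwartz_even_topology_eq schwartz_radial_topology_eq L_def[symmetric]
  proof (rule continuous_linear_map_weighted[OF schwartz_radial_eq weighted_schwartz_even_eq])
    fix m
    have "w' m h * cmod (abel_extension u f h) \<le> B * K * weighted_norm w (m + 2) f"
      if f: "f \<in> schwartz_radial Q L p" for f h
    proof -
      have "cmod (abel_extension u f h) \<le> B * weighted_norm w (m + 2) f / w' m h * K"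
        unfolding ext_eq K_def by (rule infsum_inverse_square_bound(2)[OF term_le[OF f] D0[OF f]])
      then show ?thesis using w'_pos[of m h] by (simp add: field_simps)
    qed
    moreover have "0 \<le> B * K"
      using B unfolding K_def by (intro mult_nonneg_nonneg infsum_nonneg) auto
    ultimately show "\<exists>m' C. 0 \<le> C \<and> (\<forall>f\<in>schwartz_radial Q L p. \<forall>y.
        schwartz_weight Q (1 / p - 1 / 2) (\<lambda>n. \<bar>real_of_int n\<bar>) m y * cmod (abel_extension u f y) \<le>
        C * weighted_norm (schwartz_weight Q (1 / p) (\<lambda>x. real (L x))) m' f)"
      unfolding w_def[symmetric] w'_def[symmetric] by blast
  next
    fix f g assume fg: "f \<in> schwartz_radial Q L p" "g \<in> schwartz_radial Q L p"
    have "t (\<lambda>x. f x + g x) h = (\<lambda>n. t f h n + t g h n)" for h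
      by (auto simp: t_def radial_value_def algebra_simps)
    then show "abel_extension u (\<lambda>x. f x + g x) = (\<lambda>h. abel_extension u f h + abel_extension u g h)"
      using infsum_add[OF summable[OF fg(1)] summable[OF fg(2)]] by (simp only: ext_eq fun_eq_iff) simp
  next
    fix c f
    have "t (\<lambda>x. c * f x) h = (\<lambda>n. c * t f h n)" for h
      by (auto simp: t_def radial_value_def)
    then show "abel_extension u (\<lambda>x. c * f x) = (\<lambda>h. c * abel_extension u f h)"
      by (simp add: ext_eq fun_eq_iff infsum_cmult_right')
  next
    fix f
    show "\<forall>n. abel_extension u f (- n) = abel_extension u f n"
      by (simp add: abel_extension_def abel_coeff_minus)
  qed (simp_all add: schwartz_weight_nonneg radial_diff)
qed

end

theorem proposition3p5:
  fixes E :: "'v \<Rightarrow> 'v \<Rightarrow> bool"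
    and G :: "('g, 'b) monoid_scheme"
    and \<phi> :: "'g \<Rightarrow> 'v \<Rightarrow> 'v"
    and orig :: 'v
    and L :: "'v \<Rightarrow> nat"
    and k r :: nat
    and Q :: real
  assumes "2 \<le> k" and "2 \<le> r"
    and "symmetric_graph E k r"
    and "isometric_simply_transitive G \<phi> E k"
    and "Q = (real r - 1) * (real k - 1)"
    and "L = poly_length E k orig"
  shows
    "(\<forall>p::real. 1 \<le> p \<and> p \<le> 2 \<longrightarrow>
        (\<exists>T. continuous_linear_map
               (schwartz_radial_topology Q L p)
               (weighted_schwartz_even_topology Q (1 / p - 1 / 2)) T \<and>
             (\<forall>f. radial L f \<and> finite {x. f x \<noteq> 0} \<longrightarrow>
                (\<forall>\<omega>\<in>boundary E k orig. T f = abel E k orig Q \<omega> f)))) \<and>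
     (k \<le> r \<longrightarrow>
        (\<forall>p::real. 1 \<le> p \<and> p \<le> 2 \<longrightarrow>
           (\<forall>g\<in>weighted_schwartz_even Q (1 / p - 1 / 2). \<forall>n.
              abel_inv_term k Q g n summable_on {1..}) \<and>
           continuous_linear_map
             (weighted_schwartz_even_topology Q (1 / p - 1 / 2))
             (schwartz_radial_topology Q L p)
             (\<lambda>g x. abel_inv k Q g (L x)))) \<and>
     (r < k \<longrightarrow>
        (\<forall>g\<in>weighted_schwartz_even Q (1 / 2). \<forall>n.
           abel_inv_term k Q g n summable_on {1..}) \<and>
        continuous_linear_map
          (weighted_schwartz_even_topology Q (1 / 2))
          (schwartz_radial_topology Q L 1)
          (\<lambda>g x. abel_inv k Q g (L x)))"
proof -
  interpret polygonal_graph E k r by unfold_locales (use assms in auto)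
  have Q: "Q = polygonal_graph.Q k r" using assms(5) by (simp add: Q_def)
  have Q1: "1 \<le> Q" using Q_ge_1 by (simp add: Q)
  have r1: "1 \<le> real r - 1" and k1: "0 \<le> real k - 1" using assms(1,2) by simp_all
  \<comment> \<open>For \<open>k \<le> r\<close> one has \<open>(k - 1)^2 \<le> Q\<close>, so the
    bound holds at \<open>p = 2\<close> and hence for all smaller \<open>p\<close>.\<close>
  have bound_le: "real k - 1 \<le> Q powr (1 / p)" if kr: "k \<le> r" and p: "1 \<le> p" "p \<le> 2" for p
  proof -
    have "(real k - 1) ^ 2 \<le> Q"
      unfolding assms(5) power2_eq_square using kr k1 by (intro mult_right_mono) auto
    then have "real k - 1 \<le> sqrt Q" by (rule real_le_rsqrt)
    also have "\<dots> = Q powr (1 / 2)" using Q1 by (simp add: powr_half_sqrt)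
    also have "\<dots> \<le> Q powr (1 / p)" using Q1 p by (intro powr_mono) (auto simp: field_simps)
    finally show ?thesis .
  qed
  \<comment> \<open>At \<open>p = 1\<close> the bound is \<open>k - 1 \<le> Q\<close>, which follows
    from \<open>1 \<le> r - 1\<close> for any \<open>k\<close>.\<close>
  have bound_1: "real k - 1 \<le> Q powr (1 / 1)"
    using mult_right_mono[OF r1 k1] Q1 by (simp add: assms(5)[symmetric])
  have part1: "\<exists>T. continuous_linear_map (schwartz_radial_topology Q L p)
        (weighted_schwartz_even_topology Q (1 / p - 1 / 2)) T \<and>
      (\<forall>f. radial L f \<and> finite {x. f x \<noteq> 0} \<longrightarrow> (\<forall>\<omega>\<in>boundary E k orig. T f = abel E k orig Q \<omega> f))"
    if "1 \<le> p" "p \<le> 2" for p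
    using continuous_linear_map_abel_extension[of p orig] abel_extension_eq_abel[of orig] that
    unfolding Q assms(6) by (intro exI[of _ "abel_extension orig"]) auto
  have part2: "(\<forall>g\<in>weighted_schwartz_even Q (1 / p - 1 / 2). \<forall>n. abel_inv_term k Q g n summable_on {1..}) \<and>
      continuous_linear_map (weighted_schwartz_even_topology Q (1 / p - 1 / 2))
        (schwartz_radial_topology Q L p) (\<lambda>g x. abel_inv k Q g (L x))"
    if "1 \<le> p" "p \<le> 2" "real k - 1 \<le> Q powr (1 / p)" for p
    using abel_inv_term_summable[OF Q1, of p k] continuous_linear_map_abel_inv[OF Q1, of p k L] that assms(1)
    by simp
  \<comment> \<open>The case \<open>r < k\<close> is \<open>part2\<close> at \<open>p = 1\<close>,
    where \<open>1 / p - 1 / 2\<close> is \<open>1 / 2\<close>.\<close>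
  show ?thesis
    using part1 part2 bound_le part2[of 1] bound_1 by auto
qed

end
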